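(* Let $(G,k,\gamma)$ be an instance of \textsc{Red-Blue Reinforcement}, where $G$ is a red-blue graph on $n$ vertices. One can decide whether $(G,k,\gamma)$ is a yes-instance in time $3^{dc}n^{O(1)}$, where $dc$ is the distance to cluster of $G$.
   Context: A red-blue graph is a graph $G=(V,E)$ together with sets $R,B\subseteq V$ with $V=R\cup B$ (not necessarily disjoint); vertices of $R$ are red, vertices of $B$ are blue. For $v\in V$, $N[v]$ is the closed neighborhood of $v$. The red-blue domination number $\gamma_{rb}(G)$ is the minimum size of a set $D\subseteq R$ such that $N[v]\cap D\neq\emptyset$ for every $v\in B$. For $S\subseteq V$, $G[V\setminus S]$ is the induced subgraph (with red and blue sets $R\setminus S$, $B\setminus S$). \textsc{Red-Blue Reinforcement}: given a red-blue graph $G$ and integers $k,\gamma$ (where $\gamma=\gamma_{rb}(G)-\alpha$ for a positive integer $\alpha$), decide whether there exists $S\subseteq B$ with $|S|\le k$ and $\gamma_{rb}(G[V\setminus S])\le\gamma$. A cluster graph is a disjoint union of cliques; the distance to cluster of $G$ is the minimum size of a set $M\subseteq V$ such that $G[V\setminus M]$ is a cluster graph. *)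

theory Defs
  imports Main "HOL-Library.Extended_Nat" "HOL-Library.Disjoint_Sets"
begin

section \<open>Red-blue graphs\<close>

record 'a rbgraph =
  verts :: "'a set"
  edges :: "'a set set"
  red :: "'a set"
  blue :: "'a set"

definition rb_graph :: "'a rbgraph \<Rightarrow> bool" where
  "rb_graph G \<longleftrightarrow> finite (verts G)
     \<and> edges G \<subseteq> {{u, v} |u v. u \<in> verts G \<and> v \<in> verts G \<and> u \<noteq> v}
     \<and> verts G = red G \<union> blue G"

definition closed_nbhd :: "'a rbgraph \<Rightarrow> 'a \<Rightarrow> 'a set" where
  "closed_nbhd G v = insert v {u. {u, v} \<in> edges G}"

definition induced :: "'a rbgraph \<Rightarrow> 'a set \<Rightarrow> 'a rbgraph" where
  "induced G U = \<lparr>verts = verts G \<inter> U, edges = {e \<in> edges G. e \<subseteq> U},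
                  red = red G \<inter> U, blue = blue G \<inter> U\<rparr>"

definition rb_dominating :: "'a rbgraph \<Rightarrow> 'a set \<Rightarrow> bool" where
  "rb_dominating G D \<longleftrightarrow> D \<subseteq> red G \<and> (\<forall>v \<in> blue G. closed_nbhd G v \<inter> D \<noteq> {})"

text \<open>
  A blue vertex without red closed neighbour leaves no dominating set at all; the number is
  then \<open>\<infinity>\<close>, the infimum of the empty set.
\<close>

definition rb_domination_number :: "'a rbgraph \<Rightarrow> enat" where
  "rb_domination_number G = (INF D \<in> {D. rb_dominating G D}. enat (card D))"

text \<open>
  The budgets are integers, as negative values are not excluded.
  An instance has a finite domination number, since \<open>\<gamma>\<close> is obtained from it by subtraction.
\<close>

definition rb_reinforcement_instance :: "'a rbgraph \<Rightarrow> int \<Rightarrow> int \<Rightarrow> bool" where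
  "rb_reinforcement_instance G k \<gamma> \<longleftrightarrow> rb_graph G
     \<and> (\<exists>g \<alpha>. rb_domination_number G = enat g \<and> \<alpha> > 0 \<and> \<gamma> = int g - \<alpha>)"

definition rb_reinforcement :: "'a rbgraph \<Rightarrow> int \<Rightarrow> int \<Rightarrow> bool" where
  "rb_reinforcement G k \<gamma> \<longleftrightarrow>
     (\<exists>S \<subseteq> blue G. int (card S) \<le> k
        \<and> (\<exists>g. rb_domination_number (induced G (verts G - S)) = enat g \<and> int g \<le> \<gamma>))"

definition cluster_graph :: "'a rbgraph \<Rightarrow> bool" where
  "cluster_graph G \<longleftrightarrow>
     (\<exists>P. partition_on (verts G) P
        \<and> edges G = {{u, v} |u v C. C \<in> P \<and> u \<in> C \<and> v \<in> C \<and> u \<noteq> v})"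

definition dist_to_cluster :: "'a rbgraph \<Rightarrow> nat" where
  "dist_to_cluster G =
     (LEAST d. \<exists>M \<subseteq> verts G. cluster_graph (induced G (verts G - M)) \<and> card M = d)"


section \<open>Random access machine\<close>

text \<open>
  Running time is measured on a word RAM, presented as a structured language with finitely
  many integer registers and arrays per program. The only arithmetic is addition and
  subtraction. Every assignment and every test costs one step: expressions are part of the
  fixed program, so evaluating one takes a number of machine operations bounded by a constant.

  The parameter \<open>W\<close> of the semantics is the word bound: a program gets stuck as soon
  as it stores a value, or addresses a cell, beyond \<open>W\<close> in absolute value. This rules out
  packing unbounded information into a single register, which unit cost would otherwise allow.
\<close>

type_synonym name = string

datatype aexp = Const int | Var name | Read name aexp | Add aexp aexp | Sub aexp aexp

datatype bexp = Less aexp aexp | BNot bexp | BAnd bexp bexp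

datatype com =
    Skip
  | Assign name aexp
  | Store name aexp aexp
  | Seq com com
  | Cond bexp com com
  | While bexp com

record state =
  reg :: "name \<Rightarrow> int"
  arr :: "name \<Rightarrow> int \<Rightarrow> int"

fun aval :: "aexp \<Rightarrow> state \<Rightarrow> int" where
  "aval (Const i) s = i"
| "aval (Var x) s = reg s x"
| "aval (Read a e) s = arr s a (aval e s)"
| "aval (Add e\<^sub>1 e\<^sub>2) s = aval e\<^sub>1 s + aval e\<^sub>2 s"
| "aval (Sub e\<^sub>1 e\<^sub>2) s = aval e\<^sub>1 s - aval e\<^sub>2 s"

fun addr_ok :: "int \<Rightarrow> aexp \<Rightarrow> state \<Rightarrow> bool" where
  "addr_ok W (Const i) s = True"
| "addr_ok W (Var x) s = True"
| "addr_ok W (Read a e) s = (addr_ok W e s \<and> \<bar>aval e s\<bar> \<le> W)"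
| "addr_ok W (Add e\<^sub>1 e\<^sub>2) s = (addr_ok W e\<^sub>1 s \<and> addr_ok W e\<^sub>2 s)"
| "addr_ok W (Sub e\<^sub>1 e\<^sub>2) s = (addr_ok W e\<^sub>1 s \<and> addr_ok W e\<^sub>2 s)"

fun bval :: "bexp \<Rightarrow> state \<Rightarrow> bool" where
  "bval (Less e\<^sub>1 e\<^sub>2) s = (aval e\<^sub>1 s < aval e\<^sub>2 s)"
| "bval (BNot b) s = (\<not> bval b s)"
| "bval (BAnd b\<^sub>1 b\<^sub>2) s = (bval b\<^sub>1 s \<and> bval b\<^sub>2 s)"

fun baddr_ok :: "int \<Rightarrow> bexp \<Rightarrow> state \<Rightarrow> bool" where
  "baddr_ok W (Less e\<^sub>1 e\<^sub>2) s = (addr_ok W e\<^sub>1 s \<and> addr_ok W e\<^sub>2 s)"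
| "baddr_ok W (BNot b) s = baddr_ok W b s"
| "baddr_ok W (BAnd b\<^sub>1 b\<^sub>2) s = (baddr_ok W b\<^sub>1 s \<and> (bval b\<^sub>1 s \<longrightarrow> baddr_ok W b\<^sub>2 s))"

text \<open>
  \<open>exec W c s t s'\<close>: started in \<open>s\<close>, with word bound \<open>W\<close>, the program \<open>c\<close> halts
  in \<open>s'\<close> after \<open>t\<close> steps.
\<close>

inductive exec :: "int \<Rightarrow> com \<Rightarrow> state \<Rightarrow> nat \<Rightarrow> state \<Rightarrow> bool" for W where
  Skip: "exec W Skip s 1 s"
| Assign: "addr_ok W e s \<Longrightarrow> \<bar>aval e s\<bar> \<le> W \<Longrightarrow>
    exec W (Assign x e) s 1 (s\<lparr>reg := (reg s)(x := aval e s)\<rparr>)"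
| Store: "addr_ok W i s \<Longrightarrow> addr_ok W e s \<Longrightarrow> \<bar>aval i s\<bar> \<le> W \<Longrightarrow> \<bar>aval e s\<bar> \<le> W \<Longrightarrow>
    exec W (Store a i e) s 1 (s\<lparr>arr := (arr s)(a := (arr s a)(aval i s := aval e s))\<rparr>)"
| Seq: "exec W c\<^sub>1 s t\<^sub>1 s' \<Longrightarrow> exec W c\<^sub>2 s' t\<^sub>2 s'' \<Longrightarrow> exec W (Seq c\<^sub>1 c\<^sub>2) s (t\<^sub>1 + t\<^sub>2) s''"
| CondTrue: "baddr_ok W b s \<Longrightarrow> bval b s \<Longrightarrow> exec W c\<^sub>1 s t s' \<Longrightarrow>
    exec W (Cond b c\<^sub>1 c\<^sub>2) s (t + 1) s'"
| CondFalse: "baddr_ok W b s \<Longrightarrow> \<not> bval b s \<Longrightarrow> exec W c\<^sub>2 s t s' \<Longrightarrow>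
    exec W (Cond b c\<^sub>1 c\<^sub>2) s (t + 1) s'"
| WhileFalse: "baddr_ok W b s \<Longrightarrow> \<not> bval b s \<Longrightarrow> exec W (While b c) s 1 s"
| WhileTrue: "baddr_ok W b s \<Longrightarrow> bval b s \<Longrightarrow> exec W c s t\<^sub>1 s' \<Longrightarrow> exec W (While b c) s' t\<^sub>2 s'' \<Longrightarrow>
    exec W (While b c) s (t\<^sub>1 + t\<^sub>2 + 1) s''"

inductive_cases SkipE: "exec W Skip s t s'"
inductive_cases AssignE: "exec W (Assign x e) s t s'"
inductive_cases StoreE: "exec W (Store a i e) s t s'"
inductive_cases SeqE: "exec W (Seq c\<^sub>1 c\<^sub>2) s t s'"
inductive_cases CondE: "exec W (Cond b c\<^sub>1 c\<^sub>2) s t s'"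
inductive_cases WhileE: "exec W (While b c) s t s'"

lemma exec_deterministic:
  "exec W c s t s' \<Longrightarrow> exec W c s u r \<Longrightarrow> u = t \<and> r = s'"
proof (induction arbitrary: u r rule: exec.induct)
  case (Seq c\<^sub>1 s t\<^sub>1 s' c\<^sub>2 t\<^sub>2 s'')
  from Seq.prems obtain u\<^sub>1 u\<^sub>2 r'
    where "exec W c\<^sub>1 s u\<^sub>1 r'" "exec W c\<^sub>2 r' u\<^sub>2 r" "u = u\<^sub>1 + u\<^sub>2"
    by (rule SeqE)
  with Seq.IH show ?case by metis
next
  case (WhileTrue b s c t\<^sub>1 s' t\<^sub>2 s'')
  from WhileTrue.prems obtain u\<^sub>1 u\<^sub>2 r'
    where "exec W c s u\<^sub>1 r'" "exec W (While b c) r' u\<^sub>2 r" "u = u\<^sub>1 + u\<^sub>2 + 1"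
    by (rule WhileE) (use WhileTrue.hyps(2) in simp_all)
  with WhileTrue.IH show ?case by metis
next
  case CondTrue
  from CondTrue.prems CondTrue.hyps(2) CondTrue.IH show ?case
    by (elim CondE) simp_all
next
  case CondFalse
  from CondFalse.prems CondFalse.hyps(2) CondFalse.IH show ?case
    by (elim CondE) simp_all
next
  case WhileFalse
  from WhileFalse.prems show ?case
    by (rule WhileE) (use WhileFalse.hyps(2) in simp_all)
qed (auto elim: SkipE AssignE StoreE)

text \<open>
  An input graph has vertices \<open>0, \<dots>, n - 1\<close> and is given by its adjacency matrix, stored row
  by row, and the indicator vectors of its two colour classes; all other memory is zero.
\<close>

definition input_state :: "nat rbgraph \<Rightarrow> nat \<Rightarrow> int \<Rightarrow> int \<Rightarrow> state" where
  "input_state G n k \<gamma> =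
     \<lparr>reg = (\<lambda>_. 0)(''n'' := int n, ''k'' := k, ''gamma'' := \<gamma>),
      arr = (\<lambda>_ _. 0)
        (''adj'' := (\<lambda>i. of_bool (\<exists>u < n. \<exists>v < n. i = int (u * n + v) \<and> {u, v} \<in> edges G)),
         ''red'' := (\<lambda>i. of_bool (\<exists>v \<in> red G. i = int v)),
         ''blue'' := (\<lambda>i. of_bool (\<exists>v \<in> blue G. i = int v)))\<rparr>"

end

theory Submission
  imports Defs
begin

text \<open>
  A cheapest way to lower the domination number is to fix the red set \<open>D\<close> first and to delete the
  blue vertices that \<open>D\<close> misses; the problem asks for \<open>D\<close> of size at most \<open>\<gamma>\<close> missing at
  most \<open>k\<close> blue vertices. A modulator \<open>M\<close> to a cluster graph has to hit every induced path on three
  vertices, so branching over the vertices of such a path finds one of minimum size within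
  \<open>3 ^ dc\<close> branches. Given \<open>M\<close>, the set \<open>D\<close> is built vertex by vertex, first inside \<open>M\<close> and then clique
  by clique. All that matters about the part chosen so far is which vertices of \<open>M\<close> are chosen,
  dominated or undominated (\<open>3 ^ dc\<close> possibilities), whether the current clique has been hit, and
  two counters. The reachable summaries are coded as mixed radix numbers and marked in a single pass,
  as every step increases the code.
\<close>

text \<open>The order of the scan makes the summaries sufficient. The modulator precedes all
  cliques, so when a clique is hit for the first time, the set of its blue vertices dominated from
  the modulator is final. A chosen vertex of a clique dominates the whole clique; hence one number,
  the gain of the first hit, settles the clique and no digit is spent on its vertices. The two
  position entries are the most significant digits, so a step increases the code whatever it does to
  the lower ones. The program does not know \<open>dc\<close>. It searches the branching tree
  breadth first, so that the first leaf is no deeper than the size of a minimum modulator, which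
  appears in the analysis only. The word bound limits table and tree addresses to values of the
  order of the running time, and without multiplication and division all products, weights and
  digits come from repeated addition and subtraction.\<close>

notation Seq (infixr ";;" 60) and Assign (infix "::=" 61)

section \<open>Weakest preconditions\<close>

text \<open>A run that exceeds the word bound is stuck and has no \<open>exec\<close> derivation, so
  termination, freedom from overflow and running time are proved together. The postcondition
  receives the time, and sequencing just adds times.\<close>

definition wp :: "int \<Rightarrow> com \<Rightarrow> (nat \<Rightarrow> state \<Rightarrow> bool) \<Rightarrow> state \<Rightarrow> bool" where
  "wp W c Q s \<longleftrightarrow> (\<exists>t s'. exec W c s t s' \<and> Q t s')"

lemma wp_Skip [simp]: "wp W Skip Q s \<longleftrightarrow> Q 1 s"
  unfolding wp_def by (auto intro: exec.Skip[unfolded One_nat_def] elim: SkipE)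

lemma wp_Assign [simp]:
  "wp W (Assign x e) Q s \<longleftrightarrow> addr_ok W e s \<and> \<bar>aval e s\<bar> \<le> W
     \<and> Q 1 (s\<lparr>reg := (reg s)(x := aval e s)\<rparr>)"
  unfolding wp_def by (auto intro: exec.Assign[unfolded One_nat_def] elim: AssignE)

lemma wp_Store [simp]:
  "wp W (Store a i e) Q s \<longleftrightarrow> addr_ok W i s \<and> addr_ok W e s \<and> \<bar>aval i s\<bar> \<le> W \<and> \<bar>aval e s\<bar> \<le> W
     \<and> Q 1 (s\<lparr>arr := (arr s)(a := (arr s a)(aval i s := aval e s))\<rparr>)"
  unfolding wp_def by (auto intro: exec.Store[unfolded One_nat_def] elim: StoreE)

lemma wp_Seq [simp]:
  "wp W (Seq c d) Q s \<longleftrightarrow> wp W c (\<lambda>t s'. wp W d (\<lambda>u. Q (t + u)) s') s"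
  unfolding wp_def by (blast intro: exec.intros elim: SeqE)

lemma wp_Cond [simp]:
  "wp W (Cond b c d) Q s \<longleftrightarrow> baddr_ok W b s
     \<and> (bval b s \<longrightarrow> wp W c (\<lambda>t. Q (t + 1)) s) \<and> (\<not> bval b s \<longrightarrow> wp W d (\<lambda>t. Q (t + 1)) s)"
  (is "?l \<longleftrightarrow> ?r")
proof
  assume ?l
  then show ?r unfolding wp_def by (auto elim!: CondE)
next
  assume ?r
  then show ?l unfolding wp_def by (cases "bval b s") (blast intro: CondTrue CondFalse)+
qed

lemma wp_mono: "wp W c P s \<Longrightarrow> (\<And>t s'. P t s' \<Longrightarrow> Q t s') \<Longrightarrow> wp W c Q s"
  unfolding wp_def by blast

section \<open>Memory that a program cannot change\<close>

fun written_regs :: "com \<Rightarrow> name set" where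
  "written_regs Skip = {}"
| "written_regs (Assign x e) = {x}"
| "written_regs (Store a i e) = {}"
| "written_regs (Seq c d) = written_regs c \<union> written_regs d"
| "written_regs (Cond b c d) = written_regs c \<union> written_regs d"
| "written_regs (While b c) = written_regs c"

fun written_arrs :: "com \<Rightarrow> name set" where
  "written_arrs Skip = {}"
| "written_arrs (Assign x e) = {}"
| "written_arrs (Store a i e) = {a}"
| "written_arrs (Seq c d) = written_arrs c \<union> written_arrs d"
| "written_arrs (Cond b c d) = written_arrs c \<union> written_arrs d"
| "written_arrs (While b c) = written_arrs c"

definition frame :: "com \<Rightarrow> state \<Rightarrow> state \<Rightarrow> bool" where
  "frame c s s' \<longleftrightarrow> (\<forall>x. x \<notin> written_regs c \<longrightarrow> reg s' x = reg s x)
     \<and> (\<forall>a. a \<notin> written_arrs c \<longrightarrow> arr s' a = arr s a)"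

lemma exec_frame: "exec W c s t s' \<Longrightarrow> frame c s s'"
  by (induction rule: exec.induct) (auto simp: frame_def)

text \<open>Specifications mention only what a program computes; the registers and arrays it never
  writes are recovered syntactically where the specification is applied.\<close>

lemma wp_frame:
  "wp W c P s \<Longrightarrow> (\<And>t s'. P t s' \<Longrightarrow> frame c s s' \<Longrightarrow> Q t s') \<Longrightarrow> wp W c Q s"
  unfolding wp_def using exec_frame by blast

text \<open>The invariant is indexed by the number of completed rounds. A true guard forces
  \<open>i < K\<close>, so induction on the number \<open>d\<close> of rounds still allowed
  terminates. Each round pays one test besides its body; the last 1 is the failing test.\<close>

lemma wp_While:
  assumes I0: "I 0 s"
    and addr: "\<And>i s. I i s \<Longrightarrow> baddr_ok W b s"
    and step: "\<And>i s. I i s \<Longrightarrow> bval b s \<Longrightarrow>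
      i < K \<and> wp W c (\<lambda>t s'. t \<le> T \<and> I (Suc i) s') s"
  shows "wp W (While b c) (\<lambda>t s'. t \<le> K * (T + 1) + 1 \<and> (\<exists>i. I i s' \<and> \<not> bval b s')) s"
proof -
  have "wp W (While b c) (\<lambda>t s'. t \<le> d * (T + 1) + 1 \<and> (\<exists>i. I i s' \<and> \<not> bval b s')) s"
    if "I i s" "K \<le> i + d" for i d s
    using that
  proof (induction d arbitrary: i s)
    case 0
    with step[OF 0(1)] have "\<not> bval b s" by auto
    with 0 show ?case
      unfolding wp_def by (intro exI[of _ 1] exI[of _ s]) (auto intro: exec.WhileFalse[unfolded One_nat_def] addr)
  next
    case (Suc d)
    show ?case
    proof (cases "bval b s")
      case False
      with Suc.prems show ?thesis
        unfolding wp_def by (intro exI[of _ 1] exI[of _ s]) (auto intro: exec.WhileFalse[unfolded One_nat_def] addr)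
    next
      case True
      from step[OF Suc.prems(1) True] obtain t s'
        where 1: "exec W c s t s'" "t \<le> T" "I (Suc i) s'"
        unfolding wp_def by auto
      with Suc.IH[of "Suc i" s'] Suc.prems obtain u s''
        where 2: "exec W (While b c) s' u s''" "u \<le> d * (T + 1) + 1"
          "\<exists>i. I i s'' \<and> \<not> bval b s''"
        unfolding wp_def by auto
      have "exec W (While b c) s (t + u + 1) s''"
        by (rule exec.WhileTrue[OF addr[OF Suc.prems(1)] True 1(1) 2(1)])
      moreover have "t + u + 1 \<le> Suc d * (T + 1) + 1" using 1 2 by simp
      ultimately show ?thesis unfolding wp_def using 2 by blast
    qed
  qed
  from this[OF I0] show ?thesis by simp
qed

definition For :: "name \<Rightarrow> aexp \<Rightarrow> com \<Rightarrow> com" where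
  "For x e c = x ::= Const 0 ;; While (Less (Var x) e) (c ;; x ::= Add (Var x) (Const 1))"

lemma written_For [simp]:
  "written_regs (For x e c) = insert x (written_regs c)"
  "written_arrs (For x e c) = written_arrs c"
  by (auto simp: For_def)

text \<open>Per round, 2 pays for the increment and the test; the outer 2 pays for the
  initialisation and the failing test. The bound expression is evaluated anew in every round, so it
  must have the value \<open>m\<close> in all states that differ from \<open>s\<close> only in what
  the loop writes.\<close>

lemma wp_For:
  assumes x: "x \<notin> written_regs c"
    and W: "int m \<le> W"
    and bound: "\<And>s'. frame (For x e c) s s' \<Longrightarrow> addr_ok W e s' \<and> aval e s' = int m"
    and I0: "I 0 (s\<lparr>reg := (reg s)(x := 0)\<rparr>)"
    and step: "\<And>i s'. i < m \<Longrightarrow> frame (For x e c) s s' \<Longrightarrow> reg s' x = int i \<Longrightarrow> I i s' \<Longrightarrow>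
      wp W c (\<lambda>t s''. t \<le> T \<and> I (Suc i) (s''\<lparr>reg := (reg s'')(x := int (Suc i))\<rparr>)) s'"
  shows "wp W (For x e c) (\<lambda>t s'. t \<le> m * (T + 2) + 2 \<and> I m s') s"
proof -
  let ?J = "\<lambda>i s'. i \<le> m \<and> frame (For x e c) s s' \<and> reg s' x = int i \<and> I i s'"
  have "wp W (While (Less (Var x) e) (c ;; x ::= Add (Var x) (Const 1)))
      (\<lambda>t s'. t \<le> m * ((T + 1) + 1) + 1 \<and> (\<exists>i. ?J i s' \<and> \<not> bval (Less (Var x) e) s'))
      (s\<lparr>reg := (reg s)(x := 0)\<rparr>)"
  proof (rule wp_While)
    show "?J 0 (s\<lparr>reg := (reg s)(x := 0)\<rparr>)"
      using I0 by (auto simp: frame_def)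
  next
    fix i s' assume "?J i s'"
    then show "baddr_ok W (Less (Var x) e) s'" using bound by simp
  next
    fix i s' assume J: "?J i s'" and b: "bval (Less (Var x) e) s'"
    with bound have i: "i < m" by auto
    have "wp W c (\<lambda>t s''. t \<le> T \<and> I (Suc i) (s''\<lparr>reg := (reg s'')(x := int (Suc i))\<rparr>)) s'"
      using step i J by blast
    then have "wp W (c ;; x ::= Add (Var x) (Const 1)) (\<lambda>t s''. t \<le> T + 1 \<and> ?J (Suc i) s'') s'"
      unfolding wp_Seq
    proof (rule wp_frame, goal_cases)
      case (1 t s'')
      have "reg s'' x = int i" using 1 x J by (auto simp: frame_def)
      with 1 J i W show ?case by (auto simp: frame_def add.commute)
    qed
    with i show "i < m \<and> wp W (c ;; x ::= Add (Var x) (Const 1)) (\<lambda>t s''. t \<le> T + 1 \<and> ?J (Suc i) s'') s'"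
      by blast
  qed
  then have "wp W (While (Less (Var x) e) (c ;; x ::= Add (Var x) (Const 1)))
      (\<lambda>t s'. 1 + t \<le> m * (T + 2) + 2 \<and> I m s') (s\<lparr>reg := (reg s)(x := 0)\<rparr>)"
  proof (rule wp_mono)
    fix t s'
    assume "t \<le> m * ((T + 1) + 1) + 1 \<and> (\<exists>i. ?J i s' \<and> \<not> bval (Less (Var x) e) s')"
    moreover from this obtain i where "?J i s'" "\<not> bval (Less (Var x) e) s'" by blast
    moreover from this bound have "i = m" by force
    ultimately show "1 + t \<le> m * (T + 2) + 2 \<and> I m s'" by simp
  qed
  then show ?thesis using W unfolding For_def by simp
qed

definition Eq :: "aexp \<Rightarrow> aexp \<Rightarrow> bexp" where
  "Eq a b = BAnd (BNot (Less a b)) (BNot (Less b a))"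

lemma bval_Eq [simp]: "bval (Eq a b) s \<longleftrightarrow> aval a s = aval b s"
  by (auto simp: Eq_def)

lemma baddr_ok_Eq [simp]: "baddr_ok W (Eq a b) s \<longleftrightarrow> addr_ok W a s \<and> addr_ok W b s"
  by (auto simp: Eq_def)

section \<open>Partial domination along a cluster partition\<close>

text \<open>
  The value \<open>cl v = 0\<close> marks the vertices of the modulator, the other values number the cliques.
\<close>

locale cluster_partition =
  fixes n :: nat and A :: "nat \<Rightarrow> nat \<Rightarrow> bool" and R B :: "nat set" and cl :: "nat \<Rightarrow> nat"
  assumes A_sym: "A u v \<Longrightarrow> A v u"
    and A_irrefl: "\<not> A u u"
    and A_iff_cl: "u < n \<Longrightarrow> v < n \<Longrightarrow> u \<noteq> v \<Longrightarrow> cl u \<noteq> 0 \<Longrightarrow> cl v \<noteq> 0 \<Longrightarrow> A u v \<longleftrightarrow> cl u = cl v"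
    and cl_le: "v < n \<Longrightarrow> cl v \<le> n"
begin

text \<open>
  Summaries are digit vectors: entry \<open>v < n\<close> is 0, 1 or 2 if the modulator vertex \<open>v\<close> is chosen,
  dominated, or undominated; entry \<open>n\<close> tells whether the current clique has been hit, \<open>n + 1\<close> counts
  the chosen vertices, \<open>n + 2\<close> the blue vertices outside the modulator that are dominated
  by their clique but not by a chosen modulator vertex; \<open>n + 3\<close> and \<open>n + 4\<close> are the vertex and
  the clique to be scanned next.
\<close>

definition cov :: "(nat \<Rightarrow> nat) \<Rightarrow> nat \<Rightarrow> bool" where
  "cov x i \<longleftrightarrow> (\<exists>w<n. cl w = 0 \<and> x w = 0 \<and> A i w)"

text \<open>The value of a first hit: any vertex of a clique dominates all of it, so exactly its
  blue vertices without a chosen neighbour in the modulator are new.\<close>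

definition gain :: "(nat \<Rightarrow> nat) \<Rightarrow> nat" where
  "gain x = card {i. i < n \<and> i \<in> B \<and> cl i = x (n + 4) \<and> \<not> cov x i}"

definition skip :: "(nat \<Rightarrow> nat) \<Rightarrow> nat \<Rightarrow> nat" where
  "skip x = x(n + 3 := x (n + 3) + 1)"

definition turn :: "(nat \<Rightarrow> nat) \<Rightarrow> nat \<Rightarrow> nat" where
  "turn x = x(n := 0, n + 3 := 0, n + 4 := x (n + 4) + 1)"

text \<open>In a summary the digit 2 occurs only at modulator vertices, so lowering 2 to 1 concerns
  no clique vertex, and writing 0 at a picked clique vertex repeats the digit it has anyway. The
  gain is booked at a first hit only, and never while the modulator itself is scanned.\<close>

definition pick :: "(nat \<Rightarrow> nat) \<Rightarrow> nat \<Rightarrow> nat" where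
  "pick x = (\<lambda>i. if i < n then (if i = x (n + 3) then 0
                   else if x i = 2 \<and> A i (x (n + 3)) then 1 else x i)
     else if i = n then 1
     else if i = n + 1 then x i + 1
     else if i = n + 2 then x i + (if 0 < x (n + 4) \<and> x n = 0 then gain x else 0)
     else if i = n + 3 then x i + 1
     else x i)"

definition succs :: "(nat \<Rightarrow> nat) \<Rightarrow> (nat \<Rightarrow> nat) set" where
  "succs x = (if x (n + 4) \<le> n
     then if x (n + 3) < n
       then insert (skip x) (if x (n + 3) \<in> R \<and> cl (x (n + 3)) = x (n + 4) then {pick x} else {})
       else {turn x}
     else {})"

text \<open>The digit 0 means "chosen" at a modulator vertex and is a constant filler at clique
  vertices and beyond entry \<open>n + 4\<close>. The filler allows radix 1 for clique vertices and
  makes a summary determined by its first \<open>n + 5\<close> entries.\<close>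

definition summary :: "nat set \<Rightarrow> nat \<Rightarrow> nat \<Rightarrow> nat \<Rightarrow> nat" where
  "summary D j v = (\<lambda>i. if i < n then (if cl i \<noteq> 0 \<or> i \<in> D then 0 else if \<exists>w\<in>D. A i w then 1 else 2)
     else if i = n then of_bool (\<exists>w\<in>D. cl w = j)
     else if i = n + 1 then card D
     else if i = n + 2 then
       card {i. i < n \<and> i \<in> B \<and> cl i \<noteq> 0 \<and> \<not> (\<exists>w\<in>D. cl w = 0 \<and> A i w) \<and> (\<exists>w\<in>D. cl w = cl i)}
     else if i = n + 3 then v
     else if i = n + 4 then j
     else 0)"

text \<open>These are the red vertices before position \<open>(j, v)\<close> in the lexicographic
  order by clique number and vertex; the modulator, as group 0, comes first.\<close>

definition scanned :: "nat \<Rightarrow> nat \<Rightarrow> nat set" where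
  "scanned j v = {w. w < n \<and> w \<in> R \<and> (cl w < j \<or> cl w = j \<and> w < v)}"

definition summaries :: "(nat \<Rightarrow> nat) set" where
  "summaries = {summary D j v | D j v. D \<subseteq> scanned j v \<and> v \<le> n \<and> (j \<le> n \<or> j = n + 1 \<and> v = 0)}"

lemma scanned_less: "D \<subseteq> scanned j v \<Longrightarrow> w \<in> D \<Longrightarrow> w < n"
  by (auto simp: scanned_def)

lemma finite_scanned: "D \<subseteq> scanned j v \<Longrightarrow> finite D"
  by (rule finite_subset[of _ "{..<n}"]) (auto simp: scanned_def)

lemma card_scanned: "D \<subseteq> scanned j v \<Longrightarrow> card D \<le> n"
  using card_mono[of "{..<n}" D] by (auto simp: scanned_def)

lemma cov_summary: "D \<subseteq> scanned j v \<Longrightarrow> cov (summary D j v) i \<longleftrightarrow> (\<exists>w\<in>D. cl w = 0 \<and> A i w)"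
  using scanned_less[of D j v] by (auto simp: cov_def summary_def split: if_splits)

lemma skip_summary: "skip (summary D j v) = summary D j (v + 1)"
  by (auto simp: skip_def summary_def fun_eq_iff)

lemma turn_summary:
  assumes "D \<subseteq> scanned j v"
  shows "turn (summary D j v) = summary D (j + 1) 0"
proof -
  have "\<not> (\<exists>w\<in>D. cl w = j + 1)" using assms by (auto simp: scanned_def)
  then show ?thesis by (auto simp: turn_def summary_def fun_eq_iff)
qed

text \<open>Only entry \<open>n + 2\<close> needs an argument. In group 0 no clique is hit and the
  count stays 0. In a clique hit before, nothing new is dominated. A first hit adds the disjoint set
  \<open>?g\<close>; as \<open>v\<close> is then no modulator vertex, the covering from the
  modulator does not change.\<close>

lemma pick_summary:
  assumes D: "D \<subseteq> scanned j v" and v: "v < n" "v \<in> R" "cl v = j"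
  shows "pick (summary D j v) = summary (insert v D) j (v + 1)"
proof -
  let ?x = "summary D j v"
  let ?b = "\<lambda>D. {i. i < n \<and> i \<in> B \<and> cl i \<noteq> 0 \<and> \<not> (\<exists>w\<in>D. cl w = 0 \<and> A i w) \<and> (\<exists>w\<in>D. cl w = cl i)}"
  let ?g = "{i. i < n \<and> i \<in> B \<and> cl i = j \<and> \<not> cov ?x i}"
  have vD: "v \<notin> D" using D v by (auto simp: scanned_def)
  have card: "card (insert v D) = card D + 1" using vD finite_scanned[OF D] by simp
  have old: "?x (n + 2) = card (?b D)" "?x (n + 4) = j" "?x n = of_bool (\<exists>w\<in>D. cl w = j)"
    "?x (n + 3) = v"
    by (auto simp: summary_def)
  have gain: "gain ?x = card ?g" unfolding gain_def old ..
  have "card (?b (insert v D)) = ?x (n + 2) + (if 0 < ?x (n + 4) \<and> ?x n = 0 then gain ?x else 0)"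
  proof (cases "j = 0")
    case True
    then have "cl w = 0" if "w \<in> insert v D" for w using that D v by (auto simp: scanned_def)
    then have "?b (insert v D) = {}" "?b D = {}" by auto
    then show ?thesis using True unfolding old by (simp only: True) simp
  next
    case j: False
    show ?thesis
    proof (cases "\<exists>w\<in>D. cl w = j")
      case True
      then have "?b (insert v D) = ?b D" using v j by auto
      then show ?thesis using True unfolding old by simp
    next
      case False
      have "?b (insert v D) = ?b D \<union> ?g"
        unfolding cov_summary[OF D] using v j by auto
      moreover have "?b D \<inter> ?g = {}" using False by auto
      moreover have "finite (?b D)" "finite ?g" by auto
      ultimately have "card (?b (insert v D)) = card (?b D) + card ?g"
        by (simp only: card_Un_disjoint)
      then show ?thesis using False j unfolding gain old by simp
    qed
  qed
  then have b: "summary (insert v D) j (v + 1) (n + 2) = pick ?x (n + 2)"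
    by (simp add: pick_def) (simp add: summary_def)
  show ?thesis
  proof
    fix i
    consider "i < n" | "i = n" | "i = n + 1" | "i = n + 2" | "i = n + 3" | "i = n + 4" | "i > n + 4"
      by linarith
    then show "pick ?x i = summary (insert v D) j (v + 1) i"
    proof cases
      case 1
      then show ?thesis using v
        by (simp add: pick_def old) (auto simp: summary_def)
    next
      case 4
      then show ?thesis using b by metis
    qed (use v card in \<open>auto simp: pick_def summary_def\<close>)
  qed
qed

lemma summary_pos: "summary D j v (n + 3) = v" "summary D j v (n + 4) = j"
  by (auto simp: summary_def)

lemma succs_summaries:
  assumes "x \<in> summaries" "y \<in> succs x"
  shows "y \<in> summaries"
proof -
  from assms(1) obtain D j v where x: "x = summary D j v" and D: "D \<subseteq> scanned j v"
    and v: "v \<le> n" and j: "j \<le> n \<or> j = n + 1 \<and> v = 0"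
    unfolding summaries_def by blast
  have jn: "j \<le> n" using assms(2) by (auto simp: succs_def x summary_pos split: if_splits)
  have intro: "summary D' j' v' \<in> summaries"
    if "D' \<subseteq> scanned j' v'" "v' \<le> n" "j' \<le> n \<or> j' = n + 1 \<and> v' = 0" for D' j' v'
    using that unfolding summaries_def by blast
  show ?thesis
  proof (cases "v < n")
    case True
    with assms(2) jn consider "y = skip x" | "y = pick x" "v \<in> R" "cl v = j"
      by (auto simp: succs_def x summary_pos split: if_splits)
    then show ?thesis
    proof cases
      case 1
      have "D \<subseteq> scanned j (v + 1)" using D by (auto simp: scanned_def)
      then show ?thesis unfolding 1 x skip_summary using True jn by (intro intro) auto
    next
      case 2
      have "insert v D \<subseteq> scanned j (v + 1)" using D 2 True by (auto simp: scanned_def)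
      then show ?thesis unfolding 2(1) x pick_summary[OF D True 2(2,3)] using True jn by (intro intro) auto
    qed
  next
    case False
    with assms(2) jn have y: "y = turn x" by (auto simp: succs_def x summary_pos)
    have "D \<subseteq> scanned (j + 1) 0" using D by (auto simp: scanned_def)
    then show ?thesis unfolding y x turn_summary[OF D] using jn by (intro intro) auto
  qed
qed

text \<open>The scan is undone one position at a time: either \<open>D\<close> or \<open>D\<close>
  without the vertex just passed is a legal set one position earlier. Closure of \<open>X\<close> is
  asked for at genuine summaries only, which is what the marking pass provides for the set of marked
  codes.\<close>

lemma summaries_reachable:
  assumes "summary {} 0 0 \<in> X" "\<And>x y. x \<in> X \<Longrightarrow> x \<in> summaries \<Longrightarrow> y \<in> succs x \<Longrightarrow> y \<in> X"
    and "x \<in> summaries"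
  shows "x \<in> X"
proof -
  have intro: "summary D' j' v' \<in> summaries"
    if "D' \<subseteq> scanned j' v'" "v' \<le> n" "j' \<le> n \<or> j' = n + 1 \<and> v' = 0" for D' j' v'
    using that unfolding summaries_def by blast
  have "summary D j v \<in> X"
    if "D \<subseteq> scanned j v" "v \<le> n" "j \<le> n \<or> j = n + 1 \<and> v = 0" for D j v
    using that
  proof (induction j arbitrary: D v)
    case 0
    then show ?case
    proof (induction v arbitrary: D)
      case 0
      then have "D = {}" by (auto simp: scanned_def)
      then show ?case using assms(1) by simp
    next
      case (Suc v)
      show ?case
      proof (cases "v \<in> D")
        case True
        let ?D = "D - {v}"
        have D: "?D \<subseteq> scanned 0 v" and v: "v < n" "v \<in> R" "cl v = 0"
          using Suc.prems True by (auto simp: scanned_def less_Suc_eq)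
        have "pick (summary ?D 0 v) \<in> succs (summary ?D 0 v)"
          using v by (simp add: succs_def summary_pos)
        with D v have "pick (summary ?D 0 v) \<in> X"
          by (intro assms(2)[OF Suc.IH intro]) auto
        then show ?thesis using pick_summary[OF D v] True by (simp add: insert_absorb)
      next
        case False
        have D: "D \<subseteq> scanned 0 v" using Suc.prems False by (auto simp: scanned_def less_Suc_eq)
        have "skip (summary D 0 v) \<in> succs (summary D 0 v)"
          using Suc.prems by (simp add: succs_def summary_pos)
        with D Suc.prems have "skip (summary D 0 v) \<in> X"
          by (intro assms(2)[OF Suc.IH intro]) auto
        then show ?thesis by (simp add: skip_summary)
      qed
    qed
  next
    case (Suc j)
    from Suc.prems show ?case
    proof (induction v arbitrary: D)
      case 0
      have D: "D \<subseteq> scanned j n" using 0 by (auto simp: scanned_def less_Suc_eq)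
      have "turn (summary D j n) \<in> succs (summary D j n)"
        using 0 by (auto simp add: succs_def summary_pos)
      with D 0 have "turn (summary D j n) \<in> X"
        by (intro assms(2)[OF Suc.IH intro]) auto
      then show ?case using turn_summary[OF D] by simp
    next
      case IH: (Suc v)
      show ?case
      \<comment> \<open>Membership of \<open>v\<close> in \<open>D\<close> alone is no pick here:
        \<open>v\<close> may belong to an earlier group, where it was picked, and is now merely
        skipped.\<close>
      proof (cases "v \<in> D \<and> cl v = Suc j")
        case True
        let ?D = "D - {v}"
        have D: "?D \<subseteq> scanned (Suc j) v" and v: "v < n" "v \<in> R" "cl v = Suc j"
          using IH.prems True by (auto simp: scanned_def less_Suc_eq)
        have "pick (summary ?D (Suc j) v) \<in> succs (summary ?D (Suc j) v)"
          using v IH.prems by (simp add: succs_def summary_pos)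
        with D v IH.prems have "pick (summary ?D (Suc j) v) \<in> X"
          by (intro assms(2)[OF IH.IH intro]) auto
        then show ?thesis using pick_summary[OF D v] True by (simp add: insert_absorb)
      next
        case False
        have D: "D \<subseteq> scanned (Suc j) v" using IH.prems False by (fastforce simp: scanned_def less_Suc_eq)
        have "skip (summary D (Suc j) v) \<in> succs (summary D (Suc j) v)"
          using IH.prems by (simp add: succs_def summary_pos)
        with D IH.prems have "skip (summary D (Suc j) v) \<in> X"
          by (intro assms(2)[OF IH.IH intro]) auto
        then show ?thesis by (simp add: skip_summary)
      qed
    qed
  qed
  with assms(3) show ?thesis unfolding summaries_def by blast
qed

text \<open>Domination of clique vertices from within their clique is left out on purpose: entry
  \<open>n + 2\<close> counts it and \<open>accepts\<close> subtracts it. The digits of the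
  modulator alone therefore determine this set.\<close>

definition missed :: "(nat \<Rightarrow> nat) \<Rightarrow> nat set" where
  "missed x = {i. i < n \<and> i \<in> B \<and> \<not> (cl i = 0 \<and> x i < 2) \<and> \<not> (cl i \<noteq> 0 \<and> cov x i)}"

definition accepts :: "int \<Rightarrow> int \<Rightarrow> (nat \<Rightarrow> nat) \<Rightarrow> bool" where
  "accepts k \<gamma> x \<longleftrightarrow> x (n + 4) = n + 1 \<and> int (x (n + 1)) \<le> \<gamma> \<and> int (card (missed x)) - int (x (n + 2)) \<le> k"

definition undominated :: "nat set \<Rightarrow> nat set" where
  "undominated D = {i. i < n \<and> i \<in> B \<and> (\<forall>w\<in>D. w \<noteq> i \<and> \<not> A i w)}"

lemma card_missed:
  assumes D: "D \<subseteq> scanned j v"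
  shows "card (missed (summary D j v)) = card (undominated D) + summary D j v (n + 2)"
proof -
  let ?b = "{i. i < n \<and> i \<in> B \<and> cl i \<noteq> 0 \<and> \<not> (\<exists>w\<in>D. cl w = 0 \<and> A i w) \<and> (\<exists>w\<in>D. cl w = cl i)}"
  have 1: "i \<in> missed (summary D j v) \<longleftrightarrow> i \<in> undominated D \<union> ?b" for i
  proof (cases "i < n \<and> i \<in> B")
    case False
    then show ?thesis by (auto simp: missed_def undominated_def)
  next
    case i: True
    show ?thesis
    proof (cases "cl i = 0")
      case True
      have "summary D j v i < 2 \<longleftrightarrow> (\<exists>w\<in>D. w = i \<or> A i w)"
        using i True by (auto simp: summary_def)
      then show ?thesis using i True unfolding missed_def undominated_def by auto
    next
      case False
      \<comment> \<open>The cluster property enters here: outside the modulator, being equal or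
        adjacent amounts to carrying the same clique number.\<close>
      have dom: "(w = i \<or> A i w) \<longleftrightarrow> (cl w = 0 \<and> A i w) \<or> cl w = cl i" if "w \<in> D" for w
        using A_iff_cl[of i w] False i scanned_less[OF D that] by (cases "w = i"; cases "cl w = 0") auto
      have "(\<forall>w\<in>D. w \<noteq> i \<and> \<not> A i w) \<longleftrightarrow> \<not> (\<exists>w\<in>D. cl w = 0 \<and> A i w) \<and> \<not> (\<exists>w\<in>D. cl w = cl i)"
        using dom by blast
      then show ?thesis using False i unfolding missed_def undominated_def cov_summary[OF D] by auto
    qed
  qed
  have "undominated D \<inter> ?b = {}"
  proof -
    have "\<not> (\<exists>w\<in>D. cl w = cl i)" if "i \<in> undominated D" "cl i \<noteq> 0" for i
      using A_iff_cl[of i] that scanned_less[OF D] by (fastforce simp: undominated_def)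
    then show ?thesis by blast
  qed
  moreover have "finite (undominated D)" "finite ?b" by (auto simp: undominated_def)
  moreover have "missed (summary D j v) = undominated D \<union> ?b" using 1 by (rule set_eqI)
  ultimately have "card (missed (summary D j v)) = card (undominated D) + card ?b"
    by (simp only: card_Un_disjoint)
  then show ?thesis by (simp add: summary_def)
qed

text \<open>Clique numbers are at most \<open>n\<close>, so at position \<open>(n + 1, 0)\<close>
  every red vertex has been offered and the final summaries stand for arbitrary sets of red
  vertices.\<close>

lemma accepts_iff:
  "(\<exists>x\<in>summaries. accepts k \<gamma> x) \<longleftrightarrow>
     (\<exists>D \<subseteq> R \<inter> {..<n}. int (card D) \<le> \<gamma> \<and> int (card (undominated D)) \<le> k)"
proof -
  have all: "scanned (n + 1) 0 = R \<inter> {..<n}"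
    using cl_le by (auto simp: scanned_def less_Suc_eq_le)
  have card: "summary D (n + 1) 0 (n + 1) = card D" for D by (simp add: summary_def)
  have acc: "accepts k \<gamma> (summary D (n + 1) 0) \<longleftrightarrow> int (card D) \<le> \<gamma> \<and> int (card (undominated D)) \<le> k"
    if "D \<subseteq> scanned (n + 1) 0" for D
    unfolding accepts_def card_missed[OF that] summary_pos card by simp
  show ?thesis
  proof
    assume "\<exists>x\<in>summaries. accepts k \<gamma> x"
    then obtain D j v where "accepts k \<gamma> (summary D j v)" "D \<subseteq> scanned j v"
      "j \<le> n \<or> j = n + 1 \<and> v = 0"
      unfolding summaries_def by blast
    moreover from this have "j = n + 1" by (simp add: accepts_def summary_pos)
    ultimately show "\<exists>D \<subseteq> R \<inter> {..<n}. int (card D) \<le> \<gamma> \<and> int (card (undominated D)) \<le> k"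
      using acc all by auto
  next
    assume "\<exists>D \<subseteq> R \<inter> {..<n}. int (card D) \<le> \<gamma> \<and> int (card (undominated D)) \<le> k"
    then obtain D where D: "D \<subseteq> scanned (n + 1) 0" "accepts k \<gamma> (summary D (n + 1) 0)"
      using acc all by auto
    then show "\<exists>x\<in>summaries. accepts k \<gamma> x" unfolding summaries_def by blast
  qed
qed

section \<open>Mixed radix codes of summaries\<close>

definition radix :: "nat \<Rightarrow> nat" where
  "radix i = (if n \<le> i then n + 2 else if cl i = 0 then 3 else 1)"

definition wt :: "nat \<Rightarrow> nat" where
  "wt i = (\<Prod>k<i. radix k)"

definition code :: "nat \<Rightarrow> (nat \<Rightarrow> nat) \<Rightarrow> nat" where
  "code m x = (\<Sum>i<m. x i * wt i)"

definition digit :: "nat \<Rightarrow> nat \<Rightarrow> nat" where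
  "digit q i = q mod wt (Suc i) div wt i"

lemma radix_pos: "0 < radix i" by (simp add: radix_def)

lemma wt_pos: "0 < wt i" by (simp add: wt_def radix_pos)

lemma wt_0: "wt 0 = 1" by (simp add: wt_def)

lemma wt_Suc: "wt (Suc i) = wt i * radix i" by (simp add: wt_def)

lemma wt_mono: "i \<le> j \<Longrightarrow> wt i \<le> wt j"
  by (rule lift_Suc_mono_le[of wt]) (use radix_pos in \<open>auto simp: wt_Suc Suc_leI\<close>)

lemma code_less: "(\<And>i. i < m \<Longrightarrow> x i < radix i) \<Longrightarrow> code m x < wt m"
proof (induction m)
  case 0
  then show ?case by (simp add: code_def wt_0)
next
  case (Suc m)
  have "code m x < wt m" using Suc by simp
  moreover have "(x m + 1) * wt m \<le> radix m * wt m"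
    using Suc.prems[of m] by (intro mult_right_mono) auto
  ultimately show ?case by (simp add: code_def wt_Suc algebra_simps)
qed

lemma digit_code:
  assumes "\<And>i. i < m \<Longrightarrow> x i < radix i" "i < m"
  shows "digit (code m x) i = x i"
  using assms
proof (induction m)
  case 0
  then show ?case by simp
next
  case (Suc m)
  have code: "code (Suc m) x = x m * wt m + code m x" by (simp add: code_def)
  have less: "code m x < wt m" using Suc by (intro code_less) auto
  show ?case
  proof (cases "i = m")
    case True
    have "code (Suc m) x < wt (Suc m)" using Suc by (intro code_less) auto
    then show ?thesis using less wt_pos[of m] unfolding True digit_def by (simp add: code)
  next
    case False
    then have i: "i < m" using Suc.prems by simp
    \<comment> \<open>Digits above \<open>i\<close> contribute multiples of
      \<open>wt (Suc i)\<close>, which the reduction in \<open>digit\<close> removes.\<close>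
    have "wt (Suc i) dvd wt m"
      unfolding wt_def by (rule prod_dvd_prod_subset) (use i in auto)
    then obtain c where "wt m = wt (Suc i) * c" ..
    then have "code (Suc m) x = code m x + wt (Suc i) * (c * x m)" by (simp add: code)
    then have "code (Suc m) x mod wt (Suc i) = code m x mod wt (Suc i)" by simp
    then have "digit (code (Suc m) x) i = digit (code m x) i" by (simp add: digit_def)
    then show ?thesis using Suc i by simp
  qed
qed

text \<open>The highest difference is at \<open>p\<close>, and one unit there outweighs all lower
  digits of \<open>x\<close>, provided these respect their radices. Lower digits of \<open>y\<close>
  can only enlarge its code.\<close>

lemma code_less_code:
  assumes "\<And>i. i < m \<Longrightarrow> x i < radix i" "\<And>i. p < i \<Longrightarrow> i < m \<Longrightarrow> x i = y i" "x p < y p" "p < m"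
  shows "code m x < code m y"
  using assms
proof (induction m)
  case 0
  then show ?case by simp
next
  case (Suc m)
  show ?case
  proof (cases "p = m")
    case True
    have "code m x < wt m" using Suc.prems by (intro code_less) auto
    moreover have "(x m + 1) * wt m \<le> y m * wt m"
      using Suc.prems(3) True by (intro mult_right_mono) auto
    ultimately show ?thesis by (simp add: code_def algebra_simps)
  next
    case False
    then have "code m x < code m y" using Suc by simp
    moreover have "x m = y m" using Suc.prems(2)[of m] False Suc.prems(4) by simp
    ultimately show ?thesis by (simp add: code_def)
  qed
qed

lemma summaries_less_radix:
  assumes "x \<in> summaries"
  shows "x i < radix i"
proof -
  from assms obtain D j v where x: "x = summary D j v" and D: "D \<subseteq> scanned j v"
    and v: "v \<le> n" and j: "j \<le> n + 1"
    unfolding summaries_def by auto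
  have "card {i. i < n \<and> P i} < n + 2" for P
    using card_mono[of "{..<n}" "{i. i < n \<and> P i}"] by fastforce
  then show ?thesis using card_scanned[OF D] v j unfolding x by (auto simp: summary_def radix_def)
qed

text \<open>\<open>turn\<close> raises the top digit \<open>n + 4\<close>; \<open>skip\<close> and
  \<open>pick\<close> keep it and raise digit \<open>n + 3\<close>. Decreasing digits, such as a 2
  that becomes 1 or a cleared hit flag, all lie below.\<close>

lemma code_less_succs:
  assumes "x \<in> summaries" "y \<in> succs x"
  shows "code (n + 5) x < code (n + 5) y"
proof -
  consider "y = skip x" | "y = turn x" | "y = pick x"
    using assms(2) by (auto simp: succs_def split: if_splits)
  then show ?thesis
  proof cases
    case 2
    then show ?thesis
      by (intro code_less_code[of _ _ "n + 4"] summaries_less_radix assms) (auto simp: turn_def)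
  qed (intro code_less_code[of _ _ "n + 3"] summaries_less_radix assms; force simp: skip_def pick_def)+
qed

text \<open>Clique vertices have radix 1, so only modulator vertices contribute a factor 3. The five
  tail entries share the radix \<open>n + 2\<close> because the clique position reaches
  \<open>n + 1\<close>.\<close>

lemma wt_le: "wt (n + 5) \<le> 3 ^ card {i. i < n \<and> cl i = 0} * (n + 2) ^ 5"
proof -
  have "{..<n + 5} = {..<n} \<union> {n..<n + 5}" by auto
  then have "wt (n + 5) = (\<Prod>k<n. radix k) * (\<Prod>k=n..<n + 5. radix k)"
    unfolding wt_def by (simp add: prod.union_disjoint ivl_disj_int)
  also have "(\<Prod>k=n..<n + 5. radix k) = (n + 2) ^ 5"
    by (simp add: radix_def)
  also have "(\<Prod>k<n. radix k) = (\<Prod>k<n. if cl k = 0 then 3 else 1)"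
    by (rule prod.cong) (auto simp: radix_def)
  also have "\<dots> = 3 ^ card {i. i < n \<and> cl i = 0}"
    by (simp add: prod.If_cases Int_def lessThan_def)
  finally show ?thesis by simp
qed

end

section \<open>Reinforcement and distance to cluster\<close>

text \<open>Deleting vertices only shrinks closed neighbourhoods, so a blue vertex that
  \<open>D\<close> misses in \<open>G\<close> must be deleted if \<open>D\<close> is to dominate the
  rest. Conversely, deleting exactly these vertices suffices.\<close>

lemma rb_reinforcement_iff:
  assumes "rb_graph G"
  shows "rb_reinforcement G k \<gamma> \<longleftrightarrow>
    (\<exists>D \<subseteq> red G. int (card D) \<le> \<gamma> \<and> int (card {v \<in> blue G. closed_nbhd G v \<inter> D = {}}) \<le> k)"
proof
  have fin: "finite (verts G)" and V: "verts G = red G \<union> blue G"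
    using assms by (auto simp: rb_graph_def)
  {
    assume "rb_reinforcement G k \<gamma>"
    then obtain S g where S: "S \<subseteq> blue G" "int (card S) \<le> k" and g: "int g \<le> \<gamma>"
      and num: "rb_domination_number (induced G (verts G - S)) = enat g"
      unfolding rb_reinforcement_def by blast
    let ?H = "induced G (verts G - S)"
    let ?X = "(\<lambda>D. enat (card D)) ` {D. rb_dominating ?H D}"
    \<comment> \<open>A finite domination number comes from a nonempty set of sizes, and its infimum
      is then attained as a least element.\<close>
    have "?X \<noteq> {}" using num by (auto simp: rb_domination_number_def Inf_enat_def split: if_splits)
    then have "Inf ?X \<in> ?X" unfolding Inf_enat_def using LeastI[of "\<lambda>x. x \<in> ?X"] by auto
    with num obtain D where D: "rb_dominating ?H D" and card: "card D = g"
      unfolding rb_domination_number_def by auto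
    have "{v \<in> blue G. closed_nbhd G v \<inter> D = {}} \<subseteq> S"
    proof
      fix v assume v: "v \<in> {v \<in> blue G. closed_nbhd G v \<inter> D = {}}"
      show "v \<in> S"
      proof (rule ccontr)
        assume "v \<notin> S"
        with v V have "v \<in> blue ?H" by (auto simp: induced_def)
        with D have "closed_nbhd ?H v \<inter> D \<noteq> {}" by (auto simp: rb_dominating_def)
        moreover have "closed_nbhd ?H v \<subseteq> closed_nbhd G v"
          by (auto simp: closed_nbhd_def induced_def)
        ultimately show False using v by blast
      qed
    qed
    then have "card {v \<in> blue G. closed_nbhd G v \<inter> D = {}} \<le> card S"
      using S(1) fin V by (intro card_mono) (auto intro: finite_subset)
    moreover have "D \<subseteq> red G" using D by (auto simp: rb_dominating_def induced_def)
    ultimately show "\<exists>D \<subseteq> red G. int (card D) \<le> \<gamma> \<and>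
        int (card {v \<in> blue G. closed_nbhd G v \<inter> D = {}}) \<le> k"
      using S(2) g card by (intro exI[of _ D]) simp
  }
  assume "\<exists>D \<subseteq> red G. int (card D) \<le> \<gamma> \<and> int (card {v \<in> blue G. closed_nbhd G v \<inter> D = {}}) \<le> k"
  then obtain D where D: "D \<subseteq> red G" "int (card D) \<le> \<gamma>"
    and k: "int (card {v \<in> blue G. closed_nbhd G v \<inter> D = {}}) \<le> k" by blast
  let ?S = "{v \<in> blue G. closed_nbhd G v \<inter> D = {}}"
  let ?H = "induced G (verts G - ?S)"
  \<comment> \<open>A vertex lies in its own closed neighbourhood, so \<open>D\<close> misses none
    of its members and survives the deletion.\<close>
  have DS: "D \<inter> ?S = {}" by (auto simp: closed_nbhd_def)
  have "closed_nbhd ?H v \<inter> D \<noteq> {}" if v: "v \<in> blue ?H" for v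
  proof -
    from v have "v \<in> blue G" "v \<notin> ?S" by (auto simp: induced_def)
    then obtain u where u: "u \<in> closed_nbhd G v" "u \<in> D" by blast
    with v DS D(1) V have "u \<in> closed_nbhd ?H v" by (auto simp: closed_nbhd_def induced_def)
    with u show ?thesis by blast
  qed
  moreover have "D \<subseteq> red ?H" using D(1) DS V by (auto simp: induced_def)
  ultimately have "rb_domination_number ?H \<le> enat (card D)"
    unfolding rb_domination_number_def by (intro INF_lower) (simp add: rb_dominating_def)
  then obtain g where "rb_domination_number ?H = enat g" "g \<le> card D"
    by (cases "rb_domination_number ?H") auto
  with D(2) k show "rb_reinforcement G k \<gamma>"
    unfolding rb_reinforcement_def by (intro exI[of _ ?S]) auto
qed

section \<open>Induced paths on three vertices and clusters\<close>

definition induced_path :: "(nat \<Rightarrow> nat \<Rightarrow> bool) \<Rightarrow> nat set \<Rightarrow> nat \<Rightarrow> nat \<Rightarrow> nat \<Rightarrow> bool" where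
  "induced_path A M a b c \<longleftrightarrow> a \<notin> M \<and> b \<notin> M \<and> c \<notin> M \<and> A a b \<and> A b c \<and> \<not> A a c \<and> a \<noteq> c"

text \<open>The two edges of an induced path avoiding \<open>M\<close> lie in parts that share the
  middle vertex, hence in one part, which makes the end vertices adjacent.\<close>

lemma cluster_modulator:
  assumes "rb_graph G"
  obtains M where "M \<subseteq> verts G" "card M = dist_to_cluster G"
    "\<And>a b c. a \<in> verts G \<Longrightarrow> b \<in> verts G \<Longrightarrow> c \<in> verts G \<Longrightarrow>
      \<not> induced_path (\<lambda>u v. {u, v} \<in> edges G) M a b c"
proof -
  let ?P = "\<lambda>d. \<exists>M \<subseteq> verts G. cluster_graph (induced G (verts G - M)) \<and> card M = d"
  \<comment> \<open>The least size exists because deleting all vertices leaves a cluster graph; no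
    edge remains, as \<open>{}\<close> is not an edge of \<open>G\<close>.\<close>
  have "cluster_graph (induced G (verts G - verts G))"
  proof -
    have "{} \<notin> edges G" using assms unfolding rb_graph_def by blast
    then have "induced G (verts G - verts G) = \<lparr>verts = {}, edges = {}, red = {}, blue = {}\<rparr>"
      by (auto simp: induced_def)
    then show ?thesis by (auto simp: cluster_graph_def partition_on_empty)
  qed
  then have "\<exists>d. ?P d" by blast
  then have "?P (dist_to_cluster G)" unfolding dist_to_cluster_def by (rule LeastI_ex)
  then obtain M where M: "M \<subseteq> verts G" "card M = dist_to_cluster G"
    and C: "cluster_graph (induced G (verts G - M))" by blast
  from C obtain P where P: "partition_on (verts (induced G (verts G - M))) P"
    and E: "edges (induced G (verts G - M)) = {{u, v} |u v C. C \<in> P \<and> u \<in> C \<and> v \<in> C \<and> u \<noteq> v}"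
    unfolding cluster_graph_def by (elim exE conjE) (rule that)
  have "\<not> induced_path (\<lambda>u v. {u, v} \<in> edges G) M a b c"
    if V: "a \<in> verts G" "b \<in> verts G" "c \<in> verts G" for a b c
  proof
    assume p: "induced_path (\<lambda>u v. {u, v} \<in> edges G) M a b c"
    have same: "\<exists>C\<in>P. u \<in> C \<and> v \<in> C"
      if "{u, v} \<in> edges G" "u \<notin> M" "v \<notin> M" "u \<in> verts G" "v \<in> verts G" for u v
    proof -
      have "{u, v} \<in> edges (induced G (verts G - M))" using that by (auto simp: induced_def)
      then show ?thesis unfolding E by (auto simp: doubleton_eq_iff)
    qed
    from p V same[of a b] same[of b c] obtain C C'
      where C: "C \<in> P" "a \<in> C" "b \<in> C" "C' \<in> P" "b \<in> C'" "c \<in> C'"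
      unfolding induced_path_def by blast
    with P have "C = C'" unfolding partition_on_def disjoint_def by blast
    with C p have "{a, c} \<in> edges (induced G (verts G - M))"
      unfolding E induced_path_def by blast
    with p show False by (auto simp: induced_def induced_path_def)
  qed
  with M that show ?thesis by blast
qed

text \<open>One plus the largest index below the bound satisfying \<open>P\<close>, or 0 if there is
  none. The recursion mirrors a loop whose later hits overwrite earlier ones.\<close>

fun last_before :: "(nat \<Rightarrow> bool) \<Rightarrow> nat \<Rightarrow> nat" where
  "last_before P 0 = 0"
| "last_before P (Suc i) = (if P i then Suc i else last_before P i)"

lemma last_before_le: "last_before P n \<le> n"
  by (induction n) auto

lemma last_before_cong: "(\<And>w. w < n \<Longrightarrow> P w \<longleftrightarrow> Q w) \<Longrightarrow> last_before P n = last_before Q n"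
  by (induction n) auto

lemma last_before_ex: "w < n \<Longrightarrow> P w \<Longrightarrow> \<exists>w'<n. P w' \<and> last_before P n = Suc w'"
  by (induction n) (auto simp: less_Suc_eq)

text \<open>When \<open>M\<close> hits all induced paths, a clique is named after its largest
  vertex, shifted by one so that 0 stays reserved for the modulator.\<close>

definition clique_id :: "(nat \<Rightarrow> nat \<Rightarrow> bool) \<Rightarrow> nat \<Rightarrow> nat set \<Rightarrow> nat \<Rightarrow> nat" where
  "clique_id A n M v = (if v \<in> M then 0 else last_before (\<lambda>w. w \<notin> M \<and> (w = v \<or> A v w)) n)"

lemma clique_id_eq_0: "v < n \<Longrightarrow> clique_id A n M v = 0 \<longleftrightarrow> v \<in> M"
  using last_before_ex[of v n "\<lambda>w. w \<notin> M \<and> (w = v \<or> A v w)"] by (auto simp: clique_id_def)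

text \<open>Outside \<open>M\<close>, being equal or adjacent is transitive, so adjacent vertices
  have the same closed neighbourhood and the same largest vertex in it. Conversely, with a shared
  largest vertex a missing edge would give an induced path through it.\<close>

lemma cluster_partition_clique_id:
  assumes sym: "\<And>u v. A u v \<Longrightarrow> A v u" and irrefl: "\<And>u. \<not> A u u"
    and paths: "\<And>a b c. a < n \<Longrightarrow> b < n \<Longrightarrow> c < n \<Longrightarrow> \<not> induced_path A M a b c"
  shows "cluster_partition n A (clique_id A n M)"
proof
  let ?N = "\<lambda>v w. w \<notin> M \<and> (w = v \<or> A v w)"
  fix u v assume uv: "u < n" "v < n" "u \<noteq> v" "clique_id A n M u \<noteq> 0" "clique_id A n M v \<noteq> 0"
  then have M: "u \<notin> M" "v \<notin> M" by (auto simp: clique_id_eq_0)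
  have trans: "?N u w \<longleftrightarrow> ?N v w" if "A u v" "w < n" for w
    using that sym paths[of u v w] paths[of v u w] uv M unfolding induced_path_def by blast
  show "A u v \<longleftrightarrow> clique_id A n M u = clique_id A n M v"
  proof
    assume "A u v"
    then show "clique_id A n M u = clique_id A n M v"
      using trans M by (auto simp: clique_id_def intro!: last_before_cong)
  next
    assume "clique_id A n M u = clique_id A n M v"
    then obtain w where "w < n" "?N u w" "?N v w"
      using last_before_ex[of u n "?N u"] last_before_ex[of v n "?N v"] uv M
      by (auto simp: clique_id_def)
    then show "A u v" using paths[of u w v] sym uv M unfolding induced_path_def by blast
  qed
qed (use sym irrefl last_before_le in \<open>auto simp: clique_id_def\<close>)

section \<open>Finding a modulator\<close>

text \<open>Time bounds are kept in the form \<open>K * N ^ e\<close>, so that bounds of nested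
  loops can be chained: a loop of at most \<open>a * N\<close> rounds raises the exponent by
  one.\<close>

lemma loop_time:
  fixes m T N :: nat
  assumes "m \<le> a * N" "T \<le> K * N ^ e" "1 \<le> N"
  shows "m * (T + 2) + 2 \<le> (a * (K + 2) + 2) * N ^ Suc e"
proof -
  have 1: "1 \<le> N ^ e" using assms(3) by simp
  then have "T + 2 \<le> (K + 2) * N ^ e" using assms(2) by (simp add: add_mult_distrib)
  then have "m * (T + 2) \<le> (a * N) * ((K + 2) * N ^ e)" using assms(1) by (rule mult_le_mono[rotated])
  moreover have "2 \<le> 2 * N ^ Suc e" using assms(3) by simp
  moreover have "(a * N) * ((K + 2) * N ^ e) + 2 * N ^ Suc e = (a * (K + 2) + 2) * N ^ Suc e"
    by (simp add: algebra_simps)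
  ultimately show ?thesis by linarith
qed

lemma loop_time':
  fixes m T N :: nat
  assumes "m \<le> a * N" "T \<le> K * N ^ e" "1 \<le> N" "a * (K + 2) + 2 \<le> K'" "e' = Suc e"
  shows "m * (T + 2) + 2 \<le> K' * N ^ e'"
  unfolding assms(5) by (rule le_trans[OF loop_time[OF assms(1-3)]]) (intro mult_le_mono1 assms(4))

lemma power_time: "c \<le> K * N ^ d \<Longrightarrow> d \<le> e \<Longrightarrow> 1 \<le> N \<Longrightarrow> c \<le> K * N ^ e" for c K N :: nat
  by (meson le_trans mult_le_mono2 power_increasing)

text \<open>The matrix entry sits at \<open>u * n + v\<close>, and expressions have no product;
  \<open>row\<close> tabulates the multiples \<open>u * n\<close>.\<close>

definition edge :: "aexp \<Rightarrow> aexp \<Rightarrow> aexp" where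
  "edge a b = Read ''adj'' (Add (Read ''row'' a) b)"

locale rb_input =
  fixes n :: nat and A :: "nat \<Rightarrow> nat \<Rightarrow> bool" and R B :: "nat set" and W :: int
  assumes W: "int n * int n + int n + 10 \<le> W"
begin

lemma W_small: "int n + 10 \<le> W" "0 \<le> W"
proof -
  show "int n + 10 \<le> W" using W zero_le_square[of "int n"] by linarith
  then show "0 \<le> W" by linarith
qed

text \<open>Column \<open>n\<close> is included because the running offset of
  \<open>init_rows\<close> ends at \<open>n * n\<close>.\<close>

lemma W_cell: "u < n \<Longrightarrow> v \<le> n \<Longrightarrow> int (u * n + v) \<le> W"
proof -
  assume "u < n" "v \<le> n"
  then have "u * n + v \<le> (n - 1) * n + n" by (intro add_mono mult_le_mono) auto
  also have "\<dots> = n * n" using \<open>u < n\<close> by (cases n) auto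
  finally have "int (u * n + v) \<le> int (n * n)" by linarith
  with W show ?thesis by simp
qed

text \<open>
  The predicates on states are abbreviations of predicates on the components that they read, so
  that the simplifier carries them across updates of other components.
\<close>

definition loaded_in :: "int \<Rightarrow> (int \<Rightarrow> int) \<Rightarrow> (int \<Rightarrow> int) \<Rightarrow> (int \<Rightarrow> int) \<Rightarrow> bool" where
  "loaded_in m adj rd bl \<longleftrightarrow> m = int n
     \<and> (\<forall>u<n. \<forall>v<n. adj (int (u * n + v)) = of_bool (A u v))
     \<and> (\<forall>v<n. rd (int v) = of_bool (v \<in> R))
     \<and> (\<forall>v<n. bl (int v) = of_bool (v \<in> B))"

definition ready_in where
  "ready_in m adj rd bl row \<longleftrightarrow> loaded_in m adj rd bl \<and> (\<forall>u<n. row (int u) = int (u * n))"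

abbreviation loaded :: "state \<Rightarrow> bool" where
  "loaded s \<equiv> loaded_in (reg s ''n'') (arr s ''adj'') (arr s ''red'') (arr s ''blue'')"

abbreviation ready :: "state \<Rightarrow> bool" where
  "ready s \<equiv> ready_in (reg s ''n'') (arr s ''adj'') (arr s ''red'') (arr s ''blue'') (arr s ''row'')"

lemma ready_n: "ready s \<Longrightarrow> reg s ''n'' = int n"
  unfolding ready_in_def loaded_in_def by blast

lemma ready_colour:
  "ready s \<Longrightarrow> v < n \<Longrightarrow> arr s ''red'' (int v) = of_bool (v \<in> R)"
  "ready s \<Longrightarrow> v < n \<Longrightarrow> arr s ''blue'' (int v) = of_bool (v \<in> B)"
  unfolding ready_in_def loaded_in_def by blast+

lemma ready_edge [simp]:
  assumes "ready s" "0 \<le> aval a s" "aval a s < int n" "0 \<le> aval b s" "aval b s < int n"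
  shows "aval (edge a b) s = of_bool (A (nat (aval a s)) (nat (aval b s)))"
    and "addr_ok W (edge a b) s \<longleftrightarrow> addr_ok W a s \<and> addr_ok W b s"
proof -
  obtain u v where uv: "aval a s = int u" "aval b s = int v" "u < n" "v < n"
    using assms by (metis nonneg_int_cases of_nat_less_iff)
  have row: "arr s ''row'' (int u) = int (u * n)" and adj: "arr s ''adj'' (int (u * n + v)) = of_bool (A u v)"
    using uv assms(1) unfolding ready_in_def loaded_in_def by blast+
  have sum: "aval (Add (Read ''row'' a) b) s = int (u * n + v)"
    using uv row by simp
  show "aval (edge a b) s = of_bool (A (nat (aval a s)) (nat (aval b s)))"
    unfolding edge_def aval.simps(3)[of "''adj''"] sum adj uv by simp
  have "int u \<le> W" "\<bar>aval (Add (Read ''row'' a) b) s\<bar> \<le> W"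
    using W_cell[of u v] uv W_small(1) unfolding sum by simp_all
  then show "addr_ok W (edge a b) s \<longleftrightarrow> addr_ok W a s \<and> addr_ok W b s"
    unfolding edge_def using uv by auto
qed

section \<open>Row offsets and the search for an induced path\<close>

definition init_rows :: com where
  "init_rows = ''acc'' ::= Const 0 ;;
     For ''i'' (Var ''n'')
       (Store ''row'' (Var ''i'') (Var ''acc'') ;; ''acc'' ::= Add (Var ''acc'') (Var ''n''))"

lemma wp_init_rows:
  assumes "loaded s"
  shows "wp W init_rows (\<lambda>t s'. t \<le> 7 * (n + 1) \<and> ready s') s"
  unfolding init_rows_def wp_Seq wp_Assign
proof (intro conjI, goal_cases)
  case 3
  have n: "reg s ''n'' = int n" using assms unfolding loaded_in_def by blast
  show ?case
  proof (rule wp_mono[OF wp_For[where m = n and T = 2 and I = "\<lambda>i s'. loaded s' \<and> reg s' ''acc'' = int (i * n)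
     \<and> (\<forall>u<i. arr s' ''row'' (int u) = int (u * n))"]], goal_cases)
    case (5 i s')
    have "int (i * n) \<le> W" "int (i * n + n) \<le> W" using W_cell[of i 0] W_cell[of i n] 5 by auto
    then show ?case using 5 n W_small
      by (auto simp: frame_def less_Suc_eq algebra_simps)
  next
    case (6 t s')
    then show ?case by (auto simp: ready_in_def)
  qed (use assms n W_small in \<open>simp_all add: frame_def\<close>)
qed (use W_small in auto)

definition find_path :: com where
  "find_path = ''found'' ::= Const 0 ;;
     For ''a'' (Var ''n'') (For ''b'' (Var ''n'') (For ''c'' (Var ''n'')
       (Cond (BAnd (Eq (Read ''node'' (Add (Var ''base'') (Var ''a''))) (Const 0))
             (BAnd (Eq (Read ''node'' (Add (Var ''base'') (Var ''b''))) (Const 0))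
             (BAnd (Eq (Read ''node'' (Add (Var ''base'') (Var ''c''))) (Const 0))
             (BAnd (Eq (edge (Var ''a'') (Var ''b'')) (Const 1))
             (BAnd (Eq (edge (Var ''b'') (Var ''c'')) (Const 1))
             (BAnd (Eq (edge (Var ''a'') (Var ''c'')) (Const 0))
                   (BNot (Eq (Var ''a'') (Var ''c'')))))))))
         (''found'' ::= Const 1 ;; ''pa'' ::= Var ''a'' ;; ''pb'' ::= Var ''b'' ;; ''pc'' ::= Var ''c'')
         Skip)))"

text \<open>\<open>X\<close> holds the triples inspected so far. The search runs on after a success,
  so the recorded path may be replaced by a later one.\<close>

definition search_result :: "nat set \<Rightarrow> (nat \<times> nat \<times> nat) set \<Rightarrow> int \<Rightarrow> int \<Rightarrow> int \<Rightarrow> int \<Rightarrow> bool" where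
  "search_result M X fd pa pb pc \<longleftrightarrow> fd = 0 \<and> (\<forall>(a, b, c)\<in>X. \<not> induced_path A M a b c) \<or>
     fd = 1 \<and> (\<exists>a<n. \<exists>b<n. \<exists>c<n. induced_path A M a b c \<and> pa = int a \<and> pb = int b \<and> pc = int c)"

abbreviation searched :: "nat set \<Rightarrow> (nat \<times> nat \<times> nat) set \<Rightarrow> state \<Rightarrow> bool" where
  "searched M X s \<equiv> search_result M X (reg s ''found'') (reg s ''pa'') (reg s ''pb'') (reg s ''pc'')"

lemma search_result_empty: "search_result M {} 0 pa pb pc"
  by (simp add: search_result_def)

lemma search_result_step:
  assumes "search_result M X fd pa pb pc"
  shows "induced_path A M a b c \<Longrightarrow> a < n \<Longrightarrow> b < n \<Longrightarrow> c < n \<Longrightarrow> search_result M Y 1 (int a) (int b) (int c)"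
    and "\<not> induced_path A M a b c \<Longrightarrow> search_result M (insert (a, b, c) X) fd pa pb pc"
  using assms by (auto simp: search_result_def)

lemma wp_find_path:
  assumes s: "ready s" and base: "0 \<le> reg s ''base''" "reg s ''base'' + int n \<le> W"
    and node: "\<And>v. v < n \<Longrightarrow> arr s ''node'' (reg s ''base'' + int v) = of_bool (v \<in> M)"
  shows "wp W find_path (\<lambda>t s'. t \<le> 18 * (n + 1) ^ 3 \<and>
    searched M ({..<n} \<times> {..<n} \<times> {..<n}) s') s"
proof -
  \<comment> \<open>An innermost round takes at most 5 steps: the test and four assignments.\<close>
  have t1: "n * (5 + 2) + 2 \<le> 9 * (n + 1) ^ 1" by simp
  have t2: "n * (9 * (n + 1) ^ 1 + 2) + 2 \<le> 13 * (n + 1) ^ 2"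
    by (rule loop_time'[where a = 1 and K = 9 and e = 1]) simp_all
  have t3: "n * (13 * (n + 1) ^ 2 + 2) + 2 \<le> 17 * (n + 1) ^ 3"
    by (rule loop_time'[where a = 1 and K = 13 and e = 2]) simp_all
  \<comment> \<open>The triples that precede \<open>(a, b, c)\<close> lexicographically, so that the
    invariants of all three loops belong to one family.\<close>
  define X where "X a b c = {..<a} \<times> {..<n} \<times> {..<n} \<union> {a} \<times> {..<b} \<times> {..<n} \<union> {a} \<times> {b} \<times> {..<c}" for a b c :: nat
  have X: "X a b (Suc c) = insert (a, b, c) (X a b c)" "X a (Suc b) 0 = X a b n"
    "X (Suc a) 0 0 = X a n 0" "X 0 0 0 = {}" "X n 0 0 = {..<n} \<times> {..<n} \<times> {..<n}" for a b c :: nat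
    unfolding X_def by auto
  let ?T1 = "5::nat" and ?T2 = "9 * (n + 1) ^ 1" and ?T3 = "13 * (n + 1) ^ 2"
  note s = s ready_n[OF s]
  show ?thesis
    unfolding find_path_def wp_Seq wp_Assign
  proof (intro conjI, goal_cases)
    case 3
    show ?case
    proof (rule wp_mono[OF wp_For[where m = n and T = ?T3 and I = "\<lambda>a s'. searched M (X a 0 0) s'"]], goal_cases)
      case (5 a s')
      note s1 = 5
      show ?case
      proof (rule wp_mono[OF wp_For[where m = n and T = ?T2 and I = "\<lambda>b s'. searched M (X a b 0) s'"]], goal_cases)
        case (5 b s'')
        note s2 = 5
        show ?case
        proof (rule wp_mono[OF wp_For[where m = n and T = ?T1 and I = "\<lambda>c s'. searched M (X a b c) s'"]], goal_cases)
          case (5 c s''')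
          note s3 = 5
          have "ready s'''" "reg s''' ''a'' = int a" "reg s''' ''b'' = int b" "reg s''' ''c'' = int c"
            "reg s''' ''base'' = reg s ''base''" "arr s''' ''node'' = arr s ''node''"
            using s s1 s2 s3 by (simp_all add: frame_def)
          with s1(1) s2(1) s3(1,4) base node W_small show ?case unfolding X
            by (cases "induced_path A M a b c")
              (simp_all add: search_result_step, auto simp: induced_path_def)
        qed (use s s1 s2 W_small t1 in \<open>simp_all add: frame_def X\<close>)
      qed (use s s1 W_small t2 in \<open>simp_all add: frame_def X\<close>)
    qed (use s W_small t3 in \<open>simp_all add: frame_def X search_result_empty\<close>)
  qed (use W_small in auto)
qed

section \<open>Memory layout and growth of the branching tree\<close>

definition cell :: "nat \<Rightarrow> nat \<Rightarrow> int" where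
  "cell g v = int (g * n + v)"

lemma cell_eq [simp]:
  assumes "v < n" "w < n"
  shows "cell g v = cell h w \<longleftrightarrow> g = h \<and> v = w"
proof
  assume "cell g v = cell h w"
  then have *: "g * n + v = h * n + w" by (simp only: cell_def of_nat_eq_iff)
  have lt: "g * n + v < h * n + w" if "g < h" "v < n" for g h v w
  proof -
    have "g * n + v < Suc g * n" using that(2) by simp
    also have "Suc g * n \<le> h * n" using that(1) by (intro mult_le_mono1) simp
    also have "h * n \<le> h * n + w" by simp
    finally show ?thesis .
  qed
  have "g = h"
  proof (cases g h rule: linorder_cases)
    case less
    show ?thesis using lt[OF less assms(1), of w] * by linarith
  next
    case greater
    show ?thesis using lt[OF greater assms(2), of v] * by linarith
  qed
  with * show "g = h \<and> v = w" by simp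
qed simp

lemma cell_add [simp]: "cell g 0 + int v = cell g v"
  by (simp add: cell_def)

lemma cell_n [simp]: "cell g n = cell (Suc g) 0"
  by (simp add: cell_def)

lemma cell_nonneg [simp]: "0 \<le> cell g v"
  unfolding cell_def by (rule of_nat_0_le_iff)

lemma cell_mono: "v \<le> n \<Longrightarrow> g < h \<Longrightarrow> cell g v \<le> cell h 0"
proof -
  assume "v \<le> n" "g < h"
  then have "g * n + v \<le> Suc g * n" by simp
  also have "\<dots> \<le> h * n + 0" using mult_le_mono1[of "Suc g" h n] \<open>g < h\<close> by simp
  finally show ?thesis unfolding cell_def by linarith
qed

lemma add_3: "m + 3 = Suc (Suc (Suc m))"
  by simp

text \<open>The children begin at three times the parent's address plus one, two or three blocks, so
  additions suffice to find them.\<close>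

lemma cell_child:
  "3 * cell h 0 + int n = cell (3 * h + 1) 0"
  "2 * int n + 3 * cell h 0 = cell (3 * h + 2) 0"
  "3 * int n + 3 * cell h 0 = cell (3 * h + 3) 0"
  by (simp_all add: cell_def algebra_simps)

text \<open>
  The branching tree is stored as a ternary heap: block \<open>h\<close> of the array \<open>node\<close> holds the vertex set
  of tree node \<open>h\<close>, whose children are the nodes \<open>3 * h + 1\<close>, \<open>3 * h + 2\<close> and \<open>3 * h + 3\<close>.
\<close>

definition expand :: com where
  "expand = ''b1'' ::= Add (Add (Add (Var ''base'') (Var ''base'')) (Var ''base'')) (Var ''n'') ;;
     ''b2'' ::= Add (Var ''b1'') (Var ''n'') ;;
     ''b3'' ::= Add (Var ''b2'') (Var ''n'') ;;
     For ''i'' (Var ''n'')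
       (Store ''node'' (Add (Var ''b1'') (Var ''i'')) (Read ''node'' (Add (Var ''base'') (Var ''i''))) ;;
        Store ''node'' (Add (Var ''b2'') (Var ''i'')) (Read ''node'' (Add (Var ''base'') (Var ''i''))) ;;
        Store ''node'' (Add (Var ''b3'') (Var ''i'')) (Read ''node'' (Add (Var ''base'') (Var ''i'')))) ;;
     Store ''node'' (Add (Var ''b1'') (Var ''pa'')) (Const 1) ;;
     Store ''node'' (Add (Var ''b2'') (Var ''pb'')) (Const 1) ;;
     Store ''node'' (Add (Var ''b3'') (Var ''pc'')) (Const 1) ;;
     ''base'' ::= Add (Var ''base'') (Var ''n'')"

definition heap :: "nat \<Rightarrow> (nat \<Rightarrow> nat set) \<Rightarrow> (int \<Rightarrow> int) \<Rightarrow> bool" where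
  "heap m N f \<longleftrightarrow> (\<forall>g\<le>m. \<forall>v<n. f (cell g v) = of_bool (v \<in> N g))"

text \<open>All nodes before \<open>h\<close> have been expanded, so the heap has no gaps: the nodes
  up to \<open>3 * h\<close> exist and the children of \<open>h\<close> fill the next three blocks.
  Moving \<open>base\<close> by \<open>n\<close> proceeds to the next node in breadth first
  order.\<close>

lemma wp_expand:
  assumes s: "ready s" and base: "reg s ''base'' = cell h 0"
    and abc: "reg s ''pa'' = int a" "reg s ''pb'' = int b" "reg s ''pc'' = int c" "a < n" "b < n" "c < n"
    and heap: "heap (3 * h) N (arr s ''node'')" and cells: "cell (3 * h + 4) 0 \<le> W"
  shows "wp W expand (\<lambda>t s'. t \<le> 20 * (n + 1) \<and> reg s' ''base'' = cell (Suc h) 0 \<and>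
    heap (3 * Suc h) (N(3 * h + 1 := insert a (N h), 3 * h + 2 := insert b (N h), 3 * h + 3 := insert c (N h)))
      (arr s' ''node'')) s"
proof -
  have bound: "cell g v \<le> W" if "g < 3 * h + 4" "v \<le> n" for g v
    using cell_mono[OF that(2,1)] cells by linarith
  have node: "arr s ''node'' (cell g v) = of_bool (v \<in> N g)" if "g \<le> 3 * h" "v < n" for g v
    using heap that unfolding heap_def by blast
  note s = s ready_n[OF s]
  let ?I = "\<lambda>i s'. \<forall>g\<le>3 * h + 3. \<forall>v<n. arr s' ''node'' (cell g v) =
    (if g \<le> 3 * h then of_bool (v \<in> N g) else if v < i then of_bool (v \<in> N h) else arr s ''node'' (cell g v))"
  show ?thesis
    unfolding expand_def wp_Seq[of _ "Assign x e" for x e] wp_Assign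
  proof (intro conjI, goal_cases)
    case 7
    show ?case unfolding wp_Seq[of _ "For x e d" for x e d]
    proof (rule wp_frame[OF wp_For[where m = n and T = 3 and I = ?I]], goal_cases)
      case (5 i s')
      have r: "reg s' ''b1'' = cell (3 * h + 1) 0" "reg s' ''b2'' = cell (3 * h + 2) 0"
        "reg s' ''b3'' = cell (3 * h + 3) 0" "reg s' ''base'' = cell h 0" "reg s' ''i'' = int i"
        using 5(2,3) s base by (simp_all add: frame_def cell_child add_3)
      have old: "arr s' ''node'' (cell h i) = of_bool (i \<in> N h)" using 5 by auto
      have W: "\<bar>cell h i\<bar> \<le> W" "\<bar>cell (3 * h + 1) i\<bar> \<le> W" "\<bar>cell (3 * h + 2) i\<bar> \<le> W"
        "\<bar>cell (3 * h + 3) i\<bar> \<le> W"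
        using bound 5(1) by simp_all
      have I: "arr s' ''node'' (cell g v) = (if g \<le> 3 * h then of_bool (v \<in> N g)
          else if v < i then of_bool (v \<in> N h) else arr s ''node'' (cell g v))"
        if "g \<le> 3 * h + 3" "v < n" for g v using 5(4) that by blast
      show ?case
        unfolding wp_Seq wp_Store
        using r old W 5(1) W_small
        by (simp add: I less_Suc_eq add_3)
    next
      case (6 t s')
      have r: "reg s' ''b1'' = cell (3 * h + 1) 0" "reg s' ''b2'' = cell (3 * h + 2) 0"
        "reg s' ''b3'' = cell (3 * h + 3) 0" "reg s' ''base'' = cell h 0" "reg s' ''n'' = int n"
        "reg s' ''pa'' = int a" "reg s' ''pb'' = int b" "reg s' ''pc'' = int c"
        using 6(2) s base abc by (simp_all add: frame_def cell_child add_3)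
      have W: "\<bar>cell (3 * h + 1) a\<bar> \<le> W" "\<bar>cell (3 * h + 2) b\<bar> \<le> W" "\<bar>cell (3 * h + 3) c\<bar> \<le> W"
        "cell (Suc h) 0 \<le> W"
        using bound[of _ a] bound[of _ b] bound[of _ c] bound[of "Suc h" 0] abc by simp_all
      show ?case
        unfolding wp_Seq wp_Store wp_Assign
        using r W 6(1) abc W_small
        by (simp add: heap_def add_3)
    qed (use s node W_small in \<open>simp_all add: frame_def\<close>)
  qed (use s base bound[of _ 0] in \<open>simp_all add: cell_child add_3\<close>)
qed

text \<open>
  The first bound says that node \<open>g\<close> is not too deep for its position, the last one that a node
  on the path towards the modulator \<open>M\<close> is not too far to the right; at the first leaf they combine to
  \<open>card (N h) \<le> card M\<close>.
\<close>

definition frontier :: "nat set \<Rightarrow> nat \<Rightarrow> (nat \<Rightarrow> nat set) \<Rightarrow> bool" where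
  "frontier M h N \<longleftrightarrow> (\<forall>g\<le>3 * h. N g \<subseteq> {..<n} \<and> 3 ^ card (N g) \<le> 2 * g + 1)
     \<and> (\<exists>g\<ge>h. g \<le> 3 * h \<and> N g \<subseteq> M \<and> 2 * g + 3 \<le> 3 ^ (card (N g) + 1))"

text \<open>Level \<open>d\<close> of a ternary heap consists of the \<open>g\<close> with
  \<open>3 ^ d \<le> 2 * g + 1\<close> and \<open>2 * g + 3 \<le> 3 ^ (d + 1)\<close>; both
  inequalities pass from a node to its children. If the witness inside \<open>M\<close> is the node
  being expanded, \<open>M\<close> meets its path and a child takes over; otherwise the witness
  still lies ahead.\<close>

lemma frontier_step:
  assumes f: "frontier M h N" and path: "induced_path A (N h) a b c" and abc: "a < n" "b < n" "c < n"
    and hit: "\<not> induced_path A M a b c"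
  shows "frontier M (Suc h) (N(3 * h + 1 := insert a (N h), 3 * h + 2 := insert b (N h), 3 * h + 3 := insert c (N h)))"
    (is "frontier M (Suc h) ?N")
proof -
  have N: "N g \<subseteq> {..<n}" "3 ^ card (N g) \<le> 2 * g + 1" if "g \<le> 3 * h" for g
    using f that unfolding frontier_def by blast+
  have new: "a \<notin> N h" "b \<notin> N h" "c \<notin> N h" using path by (auto simp: induced_path_def)
  have card: "card (insert x (N h)) = card (N h) + 1" if "x \<notin> N h" for x
    using that finite_subset[OF N(1)[of h]] by simp
  have child: "?N (3 * h + 1) = insert a (N h)" "?N (3 * h + 2) = insert b (N h)"
    "?N (3 * h + 3) = insert c (N h)" and old: "?N g = N g" if "g \<le> 3 * h" for g
    using that by auto
  have "?N g \<subseteq> {..<n} \<and> 3 ^ card (?N g) \<le> 2 * g + 1" if "g \<le> 3 * Suc h" for g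
  proof -
    have "g \<le> 3 * h \<or> g = 3 * h + 1 \<or> g = 3 * h + 2 \<or> g = 3 * h + 3" using that by presburger
    then show ?thesis
      using N[of g] N[of h] abc child old card[OF new(1)] card[OF new(2)] card[OF new(3)]
      by (elim disjE) simp_all
  qed
  moreover have "\<exists>g\<ge>Suc h. g \<le> 3 * Suc h \<and> ?N g \<subseteq> M \<and> 2 * g + 3 \<le> 3 ^ (card (?N g) + 1)"
  proof -
    obtain g where g: "h \<le> g" "g \<le> 3 * h" "N g \<subseteq> M" "2 * g + 3 \<le> 3 ^ (card (N g) + 1)"
      using f unfolding frontier_def by blast
    show ?thesis
    proof (cases "g = h")
      case False
      then show ?thesis using g old[of g] by (intro exI[of _ g]) auto
    next
      case True
      \<comment> \<open>Taken for the last child, whose index is largest: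
        \<open>2 * (3 * h + 3) + 3 = 3 * (2 * h + 3)\<close>.\<close>
      have grow: "2 * (3 * h + 3) + 3 \<le> 3 ^ (card (N h) + 1 + 1)" using g(4) True by simp
      have "a \<in> M \<or> b \<in> M \<or> c \<in> M"
        using hit path unfolding induced_path_def by blast
      then show ?thesis
      proof (elim disjE)
        assume "a \<in> M"
        then show ?thesis using g True child(1) card[OF new(1)] grow by (intro exI[of _ "3 * h + 1"]) simp
      next
        assume "b \<in> M"
        then show ?thesis using g True child(2) card[OF new(2)] grow by (intro exI[of _ "3 * h + 2"]) simp
      next
        assume "c \<in> M"
        then show ?thesis using g True child(3) card[OF new(3)] grow by (intro exI[of _ "3 * h + 3"]) simp
      qed
    qed
  qed
  ultimately show ?thesis unfolding frontier_def by blast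
qed

text \<open>Some node not yet expanded is contained in \<open>M\<close>, so the search has not gone
  past level \<open>card M\<close>.\<close>

lemma frontier_bound:
  assumes "frontier M h N" "finite M"
  shows "2 * h + 3 \<le> 3 ^ (card M + 1)"
proof -
  obtain g where g: "h \<le> g" "N g \<subseteq> M" "2 * g + 3 \<le> 3 ^ (card (N g) + 1)"
    using assms(1) unfolding frontier_def by blast
  have "(3::nat) ^ (card (N g) + 1) \<le> 3 ^ (card M + 1)"
    using card_mono[OF assms(2) g(2)] by (intro power_increasing) auto
  with g show ?thesis by linarith
qed

definition find_modulator :: com where
  "find_modulator = find_path ;; While (Eq (Var ''found'') (Const 1)) (expand ;; find_path)"

text \<open>\<open>M\<close> is an arbitrary set hitting all induced paths; the program runs without
  knowing its size. The assumption on \<open>W\<close> leaves room for every block that the search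
  can write.\<close>

lemma wp_find_modulator:
  assumes s: "ready s" and base: "reg s ''base'' = 0" and node: "\<And>i. arr s ''node'' i = 0"
    and M: "finite M" "\<And>a b c. a < n \<Longrightarrow> b < n \<Longrightarrow> c < n \<Longrightarrow> \<not> induced_path A M a b c"
    and W3: "int (9 * 3 ^ card M * n) \<le> W"
  shows "wp W find_modulator (\<lambda>t s'. t \<le> 200 * 3 ^ card M * (n + 1) ^ 3 \<and>
    (\<exists>N \<subseteq> {..<n}. card N \<le> card M \<and>
      (\<forall>a<n. \<forall>b<n. \<forall>c<n. \<not> induced_path A N a b c) \<and>
      0 \<le> reg s' ''base'' \<and> reg s' ''base'' + int n \<le> W \<and>
      (\<forall>v<n. arr s' ''node'' (reg s' ''base'' + int v) = of_bool (v \<in> N)))) s"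
proof -
  \<comment> \<open>The 38 is the sum of 20 for expanding a node and 18 for searching the next
    one.\<close>
  let ?X = "{..<n} \<times> {..<n} \<times> {..<n}" and ?T = "38 * (n + 1) ^ 3"
  have regs: "written_regs find_path = {''found'', ''a'', ''b'', ''c'', ''pa'', ''pb'', ''pc''}"
    "written_arrs find_path = {}"
    "written_regs expand = {''b1'', ''b2'', ''b3'', ''i'', ''base''}" "written_arrs expand = {''node''}"
    by (auto simp: find_path_def expand_def)
  define J where "J h s' \<longleftrightarrow> ready s' \<and> reg s' ''base'' = cell h 0 \<and>
    (\<exists>N. heap (3 * h) N (arr s' ''node'') \<and> frontier M h N \<and> searched (N h) ?X s')" for h s'
  have bounds: "h < 3 * 3 ^ card M \<and> cell (3 * h + 4) 0 \<le> W" if "frontier M h N" for h N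
  proof -
    have b: "2 * h + 3 \<le> 3 * 3 ^ card M" using frontier_bound[OF that M(1)] by simp
    then have "(3 * h + 4) * n \<le> 9 * 3 ^ card M * n" by (intro mult_le_mono1) linarith
    with W3 have "cell (3 * h + 4) 0 \<le> W" unfolding cell_def by linarith
    with b show ?thesis by linarith
  qed
  have find: "wp W find_path (\<lambda>t s'. t \<le> 18 * (n + 1) ^ 3 \<and> J h s') s'"
    if "ready s'" "reg s' ''base'' = cell h 0" "heap (3 * h) N (arr s' ''node'')" "frontier M h N" for h N s'
  proof (rule wp_frame[OF wp_find_path[of s' "N h"]], goal_cases)
    case 3
    then show ?case using cell_mono[of n h "3 * h + 4"] bounds[OF that(4)] that(2) by (simp del: cell_n)
  next
    case (5 t s'')
    then show ?case using that unfolding J_def by (auto simp: frame_def regs)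
  qed (use that in \<open>auto simp: heap_def\<close>)
  have init: "heap (3 * 0) (\<lambda>_. {}) (arr s ''node'')" "frontier M 0 (\<lambda>_. {})" "reg s ''base'' = cell 0 0"
    using node base by (auto simp: heap_def frontier_def cell_def)
  have loop: "wp W (While (Eq (Var ''found'') (Const 1)) (expand ;; find_path))
     (\<lambda>t s'. t \<le> 3 * 3 ^ card M * (?T + 1) + 1 \<and> (\<exists>h. J h s' \<and> \<not> bval (Eq (Var ''found'') (Const 1)) s')) s'"
    if "J 0 s'" for s'
  proof (rule wp_While)
    fix h s' assume J: "J h s'" and "bval (Eq (Var ''found'') (Const 1)) s'"
    then have found: "reg s' ''found'' = 1" by simp
    from J obtain N where N: "heap (3 * h) N (arr s' ''node'')" "frontier M h N" "searched (N h) ?X s'"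
      and s': "ready s'" "reg s' ''base'' = cell h 0" unfolding J_def by blast
    from N(3) found obtain a b c where abc: "a < n" "b < n" "c < n" and path: "induced_path A (N h) a b c"
      and p: "reg s' ''pa'' = int a" "reg s' ''pb'' = int b" "reg s' ''pc'' = int c"
      unfolding search_result_def by auto
    have "wp W (expand ;; find_path) (\<lambda>t s'. t \<le> ?T \<and> J (Suc h) s') s'"
      unfolding wp_Seq
    proof (rule wp_frame[OF wp_expand[OF s' p abc N(1)]], goal_cases)
      case 1
      show ?case using bounds[OF N(2)] by blast
    next
      case (2 t s'')
      have "ready s''" using 2(2) s' by (simp add: frame_def regs)
      moreover have "20 * (n + 1) + 18 * (n + 1) ^ 3 \<le> ?T"
        using power_time[of "20 * (n + 1)" 20 "n + 1" 1 3] by simp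
      ultimately show ?case
        using 2(1) by (intro wp_mono[OF find[OF _ _ _ frontier_step[OF N(2) path abc M(2)[OF abc]]]]) auto
    qed
    then show "h < 3 * 3 ^ card M \<and> wp W (expand ;; find_path) (\<lambda>t s'. t \<le> ?T \<and> J (Suc h) s') s'"
      using bounds[OF N(2)] by blast
  qed (use that in auto)
  show ?thesis
    unfolding find_modulator_def wp_Seq
  proof (rule wp_mono[OF find[OF s init(3,1,2)]], rule wp_mono[OF loop], goal_cases)
    case (2 t s1 u s2)
    then obtain h where J: "J h s2" and "reg s2 ''found'' \<noteq> 1" by auto
    then obtain N where N: "heap (3 * h) N (arr s2 ''node'')" "frontier M h N" "searched (N h) ?X s2"
      and s2: "reg s2 ''base'' = cell h 0" unfolding J_def by blast
    have "(3::nat) ^ card (N h) \<le> 2 * h + 1" "N h \<subseteq> {..<n}" using N(2) by (auto simp: frontier_def)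
    with frontier_bound[OF N(2) M(1)] have "(3::nat) ^ card (N h) < 3 ^ (card M + 1)" by linarith
    then have "card (N h) < card M + 1" by (rule power_less_imp_less_exp[rotated]) simp
    then have card: "card (N h) \<le> card M" by simp
    have paths: "\<forall>a<n. \<forall>b<n. \<forall>c<n. \<not> induced_path A (N h) a b c"
      using N(3) \<open>reg s2 ''found'' \<noteq> 1\<close> by (auto simp: search_result_def)
    have cells: "cell h 0 + int n \<le> W"
      using cell_mono[of n h "3 * h + 4"] bounds[OF N(2)] by (simp del: cell_n)
    have time: "t + u \<le> 200 * 3 ^ card M * (n + 1) ^ 3"
    proof -
      have "1 * 1 \<le> 3 ^ card M * (n + 1) ^ 3" by (intro mult_le_mono) auto
      moreover have "1 * (n + 1) ^ 3 \<le> 3 ^ card M * (n + 1) ^ 3" by (intro mult_le_mono) auto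
      moreover have "3 ^ card M * 1 \<le> 3 ^ card M * (n + 1) ^ 3" by (intro mult_le_mono) auto
      moreover have "t + u \<le> 18 * (n + 1) ^ 3 + (114 * (3 ^ card M * (n + 1) ^ 3) + 3 * 3 ^ card M + 1)"
        using 2 by (intro add_mono) (simp_all add: algebra_simps)
      ultimately show ?thesis by linarith
    qed
    show ?case
      using time card paths cells s2 \<open>N h \<subseteq> {..<n}\<close> N(1)
      by (intro conjI exI[of _ "N h"]) (simp_all add: heap_def)
  qed simp
qed

text \<open>The language has no disjunction; the negated conjunction says that \<open>w\<close>
  equals \<open>i\<close> or is adjacent to it. Later values of \<open>w\<close> overwrite earlier
  ones, which computes \<open>last_before\<close>.\<close>

definition clique_ids :: com where
  "clique_ids = For ''i'' (Var ''n'') (Store ''clq'' (Var ''i'') (Const 0) ;;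
     Cond (Eq (Read ''node'' (Add (Var ''base'') (Var ''i''))) (Const 1)) Skip
       (For ''w'' (Var ''n'')
         (Cond (BAnd (Eq (Read ''node'' (Add (Var ''base'') (Var ''w''))) (Const 0))
               (BNot (BAnd (BNot (Eq (Var ''w'') (Var ''i''))) (Eq (edge (Var ''i'') (Var ''w'')) (Const 0)))))
           (Store ''clq'' (Var ''i'') (Add (Var ''w'') (Const 1))) Skip)))"

lemma wp_clique_ids:
  assumes s: "ready s" and base: "0 \<le> reg s ''base''" "reg s ''base'' + int n \<le> W"
    and node: "\<And>v. v < n \<Longrightarrow> arr s ''node'' (reg s ''base'' + int v) = of_bool (v \<in> M)"
  shows "wp W clique_ids (\<lambda>t s'. t \<le> 12 * (n + 1) ^ 2 \<and>
    (\<forall>v<n. arr s' ''clq'' (int v) = int (clique_id A n M v))) s"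
proof -
  note s = s ready_n[OF s]
  let ?T = "n * (2 + 2) + 2 + 2"
  have t: "n * (?T + 2) + 2 \<le> 12 * (n + 1) ^ 2"
    by (rule loop_time'[where a = 1 and K = 8 and e = 1]) simp_all
  show ?thesis
    unfolding clique_ids_def
  proof (rule wp_mono[OF wp_For[where m = n and T = ?T and
        I = "\<lambda>i s'. \<forall>v<i. arr s' ''clq'' (int v) = int (clique_id A n M v)"]], goal_cases)
    case (5 i s')
    note s1 = 5
    let ?P = "\<lambda>w. w \<notin> M \<and> (w = i \<or> A i w)"
    have r: "reg s' ''i'' = int i" "reg s' ''base'' = reg s ''base''" "arr s' ''node'' = arr s ''node''"
      "ready s'" "reg s' ''n'' = int n"
      using s1 s by (simp_all add: frame_def)
    have node_i: "arr s ''node'' (reg s ''base'' + int i) = of_bool (i \<in> M)" using node s1 by blast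
    show ?case
    proof (cases "i \<in> M")
      case True
      then show ?thesis using r node_i s1 base W_small by (simp add: less_Suc_eq clique_id_def)
    next
      case False
      have "wp W (For ''w'' (Var ''n'')
         (Cond (BAnd (Eq (Read ''node'' (Add (Var ''base'') (Var ''w''))) (Const 0))
               (BNot (BAnd (BNot (Eq (Var ''w'') (Var ''i''))) (Eq (edge (Var ''i'') (Var ''w'')) (Const 0)))))
           (Store ''clq'' (Var ''i'') (Add (Var ''w'') (Const 1))) Skip))
        (\<lambda>t s2. t \<le> n * (2 + 2) + 2 \<and> arr s2 ''clq'' (int i) = int (last_before ?P n) \<and>
          (\<forall>v<i. arr s2 ''clq'' (int v) = int (clique_id A n M v)))
        (s'\<lparr>arr := (arr s')(''clq'' := (arr s' ''clq'')(int i := 0))\<rparr>)" (is "wp W ?c _ ?s")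
      proof (rule wp_For[where m = n and T = 2 and
          I = "\<lambda>w s2. arr s2 ''clq'' (int i) = int (last_before ?P w) \<and>
            (\<forall>v<i. arr s2 ''clq'' (int v) = int (clique_id A n M v))"], goal_cases)
        case (5 w s2)
        have "reg s2 ''i'' = int i" "reg s2 ''base'' = reg s ''base''" "arr s2 ''node'' = arr s ''node''"
          "ready s2"
          using 5 r by (simp_all add: frame_def)
        then show ?case using 5 s1(1) base node[of w] W_small by simp
      qed (use r s1 W_small in \<open>auto simp: frame_def\<close>)
      then show ?thesis using r node_i s1 base W_small False
        by (auto simp: less_Suc_eq clique_id_def elim!: wp_mono)
    qed
  qed (use s W_small t in \<open>auto simp: frame_def\<close>)
qed

text \<open>This loop pattern serves both for the gain of a clique and for the size of
  \<open>missed\<close>.\<close>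

lemma wp_count:
  assumes n: "reg s ''n'' = int n" and y: "reg s y = 0" "x \<noteq> y" "''n'' \<noteq> x" "''n'' \<noteq> y"
    and b: "\<And>i s'. i < n \<Longrightarrow> reg s' x = int i \<Longrightarrow>
      frame (For x (Var ''n'') (Cond b (y ::= Add (Var y) (Const 1)) Skip)) s s' \<Longrightarrow>
      baddr_ok W b s' \<and> (bval b s' \<longleftrightarrow> P i)"
  shows "wp W (For x (Var ''n'') (Cond b (y ::= Add (Var y) (Const 1)) Skip))
    (\<lambda>t s'. t \<le> n * 4 + 2 \<and> reg s' y = int (card {i. i < n \<and> P i})) s"
proof (rule wp_mono[OF wp_For[where m = n and T = 2 and I = "\<lambda>i s'. reg s' y = int (card {u. u < i \<and> P u})"]], goal_cases)
  case (5 i s')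
  have "{u. u < Suc i \<and> P u} = (if P i then insert i {u. u < i \<and> P u} else {u. u < i \<and> P u})"
    by (auto simp: less_Suc_eq)
  then have card: "card {u. u < Suc i \<and> P u} = card {u. u < i \<and> P u} + of_bool (P i)" by simp
  have "card {u. u < i \<and> P u} \<le> i" using card_mono[of "{..<i}" "{u. u < i \<and> P u}"] by auto
  with card b[OF 5(1,3,2)] 5 y W_small show ?case by simp
qed (use n y W_small in \<open>simp_all add: frame_def\<close>)

end

section \<open>Dynamic programming\<close>

text \<open>The additional assumption keeps every code, hence every table address, within a
  word.\<close>

locale rb_dp = rb_input n A R B W + cluster_partition n A R B cl
  for n A R B W cl +
  assumes W_wt: "int (wt (n + 5)) \<le> W"
begin

lemma radix_le: "radix i \<le> 3 * (n + 1)"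
  by (simp add: radix_def)

lemma radix_W: "int (radix i) \<le> W"
  using W_small by (simp add: radix_def)

lemma wt_W: "i \<le> n + 5 \<Longrightarrow> int (wt i) \<le> W"
  using wt_mono[of i "n + 5"] W_wt by linarith

definition clq_in :: "(int \<Rightarrow> int) \<Rightarrow> bool" where
  "clq_in f \<longleftrightarrow> (\<forall>i<n. f (int i) = int (cl i))"

definition wt_in :: "(int \<Rightarrow> int) \<Rightarrow> int \<Rightarrow> int \<Rightarrow> bool" where
  "wt_in f l q \<longleftrightarrow> (\<forall>i<n + 5. f (int i) = int (wt i)) \<and> l = int (n + 5) \<and> q = int (wt (n + 5))"

definition digits_in :: "(nat \<Rightarrow> nat) \<Rightarrow> (int \<Rightarrow> int) \<Rightarrow> bool" where
  "digits_in x f \<longleftrightarrow> (\<forall>i<n + 5. f (int i) = int (x i))"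

abbreviation prepared :: "state \<Rightarrow> bool" where
  "prepared s \<equiv> ready s \<and> reg s ''n'' = int n \<and> clq_in (arr s ''clq'') \<and>
     wt_in (arr s ''wt'') (reg s ''len'') (reg s ''size'')"

lemma clq_inD: "clq_in f \<Longrightarrow> i < n \<Longrightarrow> f (int i) = int (cl i)"
  unfolding clq_in_def by blast

lemma wt_inD:
  "wt_in f l q \<Longrightarrow> i < n + 5 \<Longrightarrow> f (int i) = int (wt i)"
  "wt_in f l q \<Longrightarrow> l = int (n + 5)" "wt_in f l q \<Longrightarrow> q = int (wt (n + 5))"
  unfolding wt_in_def by blast+

lemma digits_inD: "digits_in x f \<Longrightarrow> i < n + 5 \<Longrightarrow> f (int i) = int (x i)"
  unfolding digits_in_def by blast

section \<open>Conversion between digit vectors and codes\<close>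

definition weights :: com where
  "weights = ''len'' ::= Add (Var ''n'') (Const 5) ;; ''acc'' ::= Const 1 ;;
     For ''i'' (Var ''len'')
      (Store ''wt'' (Var ''i'') (Var ''acc'') ;;
       ''radix'' ::= Const 1 ;;
       Cond (Eq (Read ''clq'' (Var ''i'')) (Const 0)) (''radix'' ::= Const 3) Skip ;;
       Cond (Less (Var ''i'') (Var ''n'')) Skip (''radix'' ::= Add (Var ''n'') (Const 2)) ;;
       ''tmp'' ::= Var ''acc'' ;; ''acc'' ::= Const 0 ;;
       For ''r'' (Var ''radix'') (''acc'' ::= Add (Var ''acc'') (Var ''tmp''))) ;;
     ''size'' ::= Var ''acc''"

text \<open>The next weight arises by adding the current one \<open>radix i\<close> times. At the
  five tail entries the test on \<open>clq\<close> reads beyond the vertices, but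
  \<open>n + 2\<close> then overwrites its effect.\<close>

lemma wp_weights:
  assumes s: "ready s" "clq_in (arr s ''clq'')"
  shows "wp W weights (\<lambda>t s'. t \<le> 130 * (n + 1) ^ 2 \<and> prepared s') s"
proof -
  note s = s ready_n[OF s(1)]
  let ?T = "22 * (n + 1) ^ 1"
  have "(n + 5) * (?T + 2) + 2 \<le> 122 * (n + 1) ^ 2"
    by (rule loop_time'[where a = 5 and K = 22 and e = 1]) simp_all
  moreover have "1 \<le> (n + 1) ^ 2" by simp
  ultimately have t: "(n + 5) * (?T + 2) + 2 + 4 \<le> 126 * (n + 1) ^ 2" by linarith
  let ?I = "\<lambda>i s'. reg s' ''acc'' = int (wt i) \<and> (\<forall>k<i. arr s' ''wt'' (int k) = int (wt k))"
  show ?thesis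
    unfolding weights_def wp_Seq[of _ "Assign x e" for x e] wp_Assign
  proof (intro conjI, goal_cases)
    case 5
    show ?case unfolding wp_Seq[of _ "For x e c" for x e c]
    proof (rule wp_frame[OF wp_For[where m = "n + 5" and T = ?T and I = ?I]], goal_cases)
      case (5 i s')
      have r: "reg s' ''i'' = int i" "reg s' ''n'' = int n" "clq_in (arr s' ''clq'')"
        using 5 s by (simp_all add: frame_def)
      have bounds: "int (wt i) \<le> W" "int (wt (Suc i)) \<le> W" using 5(1) wt_W[of i] wt_W[of "Suc i"] by simp_all
      have inner: "wp W (For ''r'' (Var ''radix'') (Assign ''acc'' (Add (Var ''acc'') (Var ''tmp''))))
        (\<lambda>t s2. t \<le> radix i * (1 + 2) + 2 \<and> reg s2 ''acc'' = int (radix i * wt i)) s1"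
        if r1: "reg s1 ''radix'' = int (radix i)" "reg s1 ''tmp'' = int (wt i)" "reg s1 ''acc'' = 0" for s1
      proof (rule wp_For[where m = "radix i" and T = 1 and I = "\<lambda>k s2. reg s2 ''acc'' = int (k * wt i)"], goal_cases)
        case (5 k s2)
        have "Suc k * wt i \<le> radix i * wt i" using 5(1) by (intro mult_le_mono1) simp
        then have "int (Suc k * wt i) \<le> W" using bounds(2) unfolding wt_Suc mult.commute[of "wt i"] by linarith
        then show ?case using 5 r1 by (simp add: frame_def algebra_simps)
      qed (use r1 W_small radix_le[of i] in \<open>auto simp: frame_def radix_def\<close>)
      have rest: "wp W (''tmp'' ::= Var ''acc'' ;; ''acc'' ::= Const 0 ;;
          For ''r'' (Var ''radix'') (''acc'' ::= Add (Var ''acc'') (Var ''tmp'')))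
        (\<lambda>t s2. u + t \<le> ?T \<and> ?I (Suc i) (s2\<lparr>reg := (reg s2)(''i'' := int (Suc i))\<rparr>)) s1"
        if r1: "reg s1 ''radix'' = int (radix i)" "reg s1 ''acc'' = int (wt i)" "u \<le> 6"
          "\<forall>k<Suc i. arr s1 ''wt'' (int k) = int (wt k)" for u s1
        unfolding wp_Seq wp_Assign
      proof (intro conjI, goal_cases)
        case 5
        show ?case
          using r1 radix_le[of i]
          by (intro wp_frame[OF inner]) (auto simp: frame_def wt_Suc mult.commute algebra_simps)
      qed (use r1 W_small bounds in simp_all)
      have clq: "i < n \<Longrightarrow> arr s' ''clq'' (int i) = int (cl i)" using r(3) clq_inD by blast
      show ?case unfolding wp_Seq[of _ "Store x a e" for x a e] wp_Seq[of _ "Assign ''radix'' e" for e] 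
          wp_Seq[of _ "Cond b c d" for b c d]
        using r clq 5(1,4) bounds W_small
        by (cases "i < n"; cases "cl i = 0"; simp add: less_Suc_eq del: wp_Seq)
          (rule wp_mono[OF rest[of _ 6]]; simp add: radix_def less_Suc_eq)+
    next
      case (6 t s')
      then show ?case using W_wt s t by (simp add: frame_def wt_in_def)
    qed (use s W_small in \<open>simp_all add: frame_def wt_0\<close>)
  qed (use s W_small in simp_all)
qed

definition mark :: com where
  "mark = ''e'' ::= Const 0 ;;
     For ''i'' (Var ''len'')
       (For ''r'' (Read ''dg'' (Var ''i'')) (''e'' ::= Add (Var ''e'') (Read ''wt'' (Var ''i'')))) ;;
     Store ''tab'' (Var ''e'') (Const 1)"

text \<open>Each digit serves as a loop bound, so \<open>x i * wt i\<close> is formed by repeated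
  addition. As digits stay below their radices, partial sums fit into a word and the two nested
  loops take quadratic time.\<close>

lemma wp_mark:
  assumes s: "prepared s" and x: "digits_in x (arr s ''dg'')" "\<And>i. x i < radix i"
  shows "wp W mark (\<lambda>t s'. t \<le> 80 * (n + 1) ^ 2 \<and>
    arr s' ''tab'' = (arr s ''tab'')(int (code (n + 5) x) := 1)) s"
proof -
  note s = s ready_n[OF conjunct1[OF s]]
  let ?T = "11 * (n + 1) ^ 1"
  have "(n + 5) * (?T + 2) + 2 \<le> 67 * (n + 1) ^ 2"
    by (rule loop_time'[where a = 5 and K = 11 and e = 1]) simp_all
  moreover have "1 \<le> (n + 1) ^ 2" by simp
  ultimately have t: "(n + 5) * (?T + 2) + 2 + 4 \<le> 71 * (n + 1) ^ 2" by linarith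
  have wt: "arr s ''wt'' (int i) = int (wt i)" and dg: "arr s ''dg'' (int i) = int (x i)"
    if "i < n + 5" for i
    using s x(1) that wt_inD(1) digits_inD by blast+
  have len: "reg s ''len'' = int (n + 5)" using s wt_inD(2) by blast
  have code_W: "int (code m x) \<le> W" if "m \<le> n + 5" for m
    using code_less[of m x] x(2) wt_W[OF that] by fastforce
  show ?thesis
    unfolding mark_def wp_Seq[of _ "Assign x e" for x e] wp_Assign
  proof (intro conjI, goal_cases)
    case 3
    show ?case unfolding wp_Seq[of _ "For x e c" for x e c]
    proof (rule wp_frame[OF wp_For[where m = "n + 5" and T = ?T and I = "\<lambda>i s'. reg s' ''e'' = int (code i x)"]], goal_cases)
      case (5 i s')
      note s1 = 5
      show ?case
      proof (rule wp_mono[OF wp_For[where m = "x i" and T = 1 and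
            I = "\<lambda>k s'. reg s' ''e'' = int (code i x + k * wt i)"]], goal_cases)
        case (5 k s'')
        have "Suc k * wt i \<le> x i * wt i" using 5(1) by (intro mult_le_mono1) simp
        then have "code i x + Suc k * wt i \<le> code (Suc i) x" by (simp add: code_def)
        then have "int (code i x + Suc k * wt i) \<le> W"
          using code_W[of "Suc i"] s1(1) by linarith
        moreover have "arr s'' ''wt'' (int i) = int (wt i)" "reg s'' ''i'' = int i"
          using s1(1) 5(2) s1 by (simp_all add: frame_def wt)
        ultimately show ?case using 5 W_small s1(1) by (simp add: algebra_simps)
      next
        case (6 t s'')
        then show ?case using x(2)[of i] radix_le[of i] by (simp add: code_def)
      qed (use x(2)[of i] radix_W[of i] 5 dg W_small in \<open>simp_all add: frame_def\<close>)
    next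
      case (6 t s')
      then show ?case using code_W[of "n + 5"] W_small t by (simp add: frame_def)
    qed (use W_small len in \<open>simp_all add: frame_def code_def\<close>)
  qed (use W_small in simp_all)
qed

lemma preparedD:
  assumes "prepared s"
  shows "ready s" "reg s ''n'' = int n" "clq_in (arr s ''clq'')"
    "wt_in (arr s ''wt'') (reg s ''len'') (reg s ''size'')"
  using assms by blast+

definition decode :: com where
  "decode = ''e'' ::= Var ''q'' ;;
     For ''i'' (Var ''len'')
       (''idx'' ::= Sub (Sub (Var ''len'') (Const 1)) (Var ''i'') ;;
        Store ''dg'' (Var ''idx'') (Const 0) ;;
        While (BNot (Less (Var ''e'') (Read ''wt'' (Var ''idx''))))
          (''e'' ::= Sub (Var ''e'') (Read ''wt'' (Var ''idx'')) ;;
           Store ''dg'' (Var ''idx'') (Add (Read ''dg'' (Var ''idx'')) (Const 1))))"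

text \<open>Digits are split off greedily from the top: after \<open>i\<close> rounds
  \<open>e\<close> is \<open>q\<close> modulo \<open>wt (n + 5 - i)\<close>, and the next digit is
  the number of times the next weight can be subtracted.\<close>

lemma wp_decode:
  assumes s: "prepared s" and q: "reg s ''q'' = int q" "q < wt (n + 5)"
  shows "wp W decode (\<lambda>t s'. t \<le> 80 * (n + 1) ^ 2 \<and> digits_in (digit q) (arr s' ''dg'')) s"
proof -
  let ?T = "12 * (n + 1) ^ 1"
  have "(n + 5) * (?T + 2) + 2 \<le> 72 * (n + 1) ^ 2"
    by (rule loop_time'[where a = 5 and K = 12 and e = 1]) simp_all
  moreover have "1 \<le> (n + 1) ^ 2" by simp
  ultimately have t: "(n + 5) * (?T + 2) + 2 + 1 \<le> 80 * (n + 1) ^ 2" by linarith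
  have wt: "arr s ''wt'' (int i) = int (wt i)" if "i < n + 5" for i
    using s that wt_inD(1) by blast
  have len: "reg s ''len'' = int (n + 5)" using s wt_inD(2) by blast
  let ?I = "\<lambda>i s'. reg s' ''e'' = int (q mod wt (n + 5 - i)) \<and>
    (\<forall>k. n + 5 - i \<le> k \<longrightarrow> k < n + 5 \<longrightarrow> arr s' ''dg'' (int k) = int (digit q k))"
  show ?thesis
    unfolding decode_def wp_Seq[of _ "Assign x e" for x e] wp_Assign
  proof (intro conjI, goal_cases)
    case 3
    show ?case
    proof (rule wp_mono[OF wp_For[where m = "n + 5" and T = ?T and I = ?I]], goal_cases)
      case (5 i s')
      define p where "p = n + 4 - i"
      have p: "p < n + 5" "n + 5 - i = Suc p" "n + 5 - Suc i = p" using 5(1) by (auto simp: p_def)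
      define e0 where "e0 = q mod wt (Suc p)"
      have e0: "e0 < wt p * radix p" unfolding e0_def wt_Suc[symmetric] using wt_pos by simp
      have r: "reg s' ''i'' = int i" "reg s' ''len'' = int (n + 5)" "arr s' ''wt'' (int p) = int (wt p)"
        "reg s' ''e'' = int e0"
        using 5 len wt[OF p(1)] p by (simp_all add: frame_def e0_def)
      define s0 where "s0 = s'\<lparr>reg := (reg s')(''idx'' := int p), arr := (arr s')(''dg'' := (arr s' ''dg'')(int p := 0))\<rparr>"
      \<comment> \<open>The state after \<open>c\<close> subtractions is described completely: only
        \<open>e\<close> and one cell of \<open>dg\<close> differ from \<open>s0\<close>.\<close>
      define J where "J c s2 \<longleftrightarrow> c * wt p \<le> e0 \<and>
        s2 = s0\<lparr>reg := (reg s0)(''e'' := int (e0 - c * wt p)), arr := (arr s0)(''dg'' := (arr s0 ''dg'')(int p := int c))\<rparr>" for c s2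
      have pW: "int p \<le> W" using p W_small by linarith
      have e0W: "int e0 \<le> W" using e0 wt_W[of "Suc p"] p(1) unfolding wt_Suc by linarith
      have r0: "reg s0 ''idx'' = int p" "arr s0 ''wt'' (int p) = int (wt p)"
        using r by (simp_all add: s0_def)
      have loop: "wp W (While (BNot (Less (Var ''e'') (Read ''wt'' (Var ''idx''))))
          (''e'' ::= Sub (Var ''e'') (Read ''wt'' (Var ''idx'')) ;;
           Store ''dg'' (Var ''idx'') (Add (Read ''dg'' (Var ''idx'')) (Const 1))))
        (\<lambda>t s2. t \<le> radix p * (2 + 1) + 1 \<and>
          (\<exists>c. J c s2 \<and> \<not> bval (BNot (Less (Var ''e'') (Read ''wt'' (Var ''idx'')))) s2)) s0"
      proof (rule wp_While, goal_cases)
        case 1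
        have "(reg s')(''idx'' := int p, ''e'' := int e0) = (reg s')(''idx'' := int p)"
          using r by (auto simp: fun_eq_iff)
        then show ?case by (simp add: J_def s0_def)
      next
        case (2 c s2)
        then show ?case using r0 pW by (simp add: J_def)
      next
        case (3 c s2)
        have "int (c * wt p + wt p) \<le> int e0" using 3 r0 by (auto simp: J_def)
        then have le: "Suc c * wt p \<le> e0" by (simp only: of_nat_le_iff mult_Suc add.commute)
        \<comment> \<open>Since \<open>e0\<close> is below \<open>wt (Suc p)\<close>, fewer than
          \<open>radix p\<close> subtractions are possible; this bounds the rounds.\<close>
        then have "Suc c * wt p < radix p * wt p" using e0 by (simp add: mult.commute)
        then have c: "Suc c < radix p" by (rule mult_less_cancel2[THEN iffD1, THEN conjunct2])
        have "int (Suc c * wt p) \<le> int e0" using le by (simp only: of_nat_le_iff)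
        then have "int c * int (wt p) + int (wt p) \<le> int e0" by (simp add: algebra_simps)
        moreover have "0 \<le> int c * int (wt p)" by simp
        ultimately have "\<bar>int e0 - int c * int (wt p) - int (wt p)\<bar> \<le> W" using e0W by linarith
        then show ?case
          using 3(1) r0 le c pW radix_W[of p] unfolding J_def by (simp add: algebra_simps)
      qed
      have idx: "4 + int n - int i = int p" using p_def 5(1) by simp
      show ?case unfolding wp_Seq[of _ "Assign x e" for x e] wp_Seq[of _ "Store a x e" for a x e] wp_Assign wp_Store
      proof (intro conjI, goal_cases)
        case 7
        show ?case
        \<comment> \<open>The loop starts in \<open>s0\<close> only after the index expression is
          evaluated; the substitution separates that equation from the argument about the
          loop.\<close>
        proof (rule wp_mono[of W _ _ s0, OF loop, THEN back_subst[of "wp W _ _"]], goal_cases)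
          case (1 t s2)
          then obtain c where J: "J c s2" and exit: "\<not> bval (BNot (Less (Var ''e'') (Read ''wt'' (Var ''idx'')))) s2"
            by blast
          from J have le: "c * wt p \<le> e0" by (simp add: J_def)
          have "int e0 < int (c * wt p + wt p)" using J exit r0 by (auto simp: J_def)
          then have less: "e0 < c * wt p + wt p" by (simp only: of_nat_less_iff)
          have e0c: "e0 = (e0 - c * wt p) + c * wt p" using le by simp
          have small: "e0 - c * wt p < wt p" using less le by linarith
          have "e0 div wt p = c" using e0c small by (metis div_less div_mult_self2 add_0_right less_nat_zero_code mult.commute wt_pos neq0_conv)
          then have c: "c = digit q p" by (simp add: digit_def e0_def)
          have "e0 mod wt p = e0 - c * wt p" using e0c small by (metis mod_less mod_mult_self1)
          moreover have "e0 mod wt p = q mod wt p" unfolding e0_def wt_Suc by (simp add: mod_mod_cancel)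
          ultimately have e: "e0 - c * wt p = q mod wt p" by simp
          have "radix p * (2 + 1) + 1 + 2 \<le> ?T" using radix_le[of p] by simp
          with 1 have time: "1 + (1 + t) \<le> ?T" by linarith
          have dg: "arr s2 ''dg'' (int k) = int (digit q k)" if "p \<le> k" "k < n + 5" for k
            using that J c 5(4) p(2) by (cases "k = p") (auto simp: J_def s0_def)
          show ?case using time dg J e p(3) by (auto simp: J_def)
        next
          case 2
          show ?case unfolding s0_def using r idx by simp
        qed
      qed (use r idx pW W_small in simp_all)
    next
      case (6 t s')
      then show ?case using t by (simp add: digits_in_def)
    qed (use q W_small len in \<open>simp_all add: frame_def\<close>)
  qed (use q W_wt W_small in simp_all)
qed

section \<open>Programs for one transition and for the final test\<close>

definition cover :: com where
  "cover = For ''i'' (Var ''n'') (Store ''xc'' (Var ''i'') (Const 0) ;;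
     For ''w'' (Var ''n'')
       (Cond (BAnd (Eq (Read ''clq'' (Var ''w'')) (Const 0))
             (BAnd (Eq (Read ''dg'' (Var ''w'')) (Const 0)) (Eq (edge (Var ''i'') (Var ''w'')) (Const 1))))
         (Store ''xc'' (Var ''i'') (Const 1)) Skip))"

lemma wp_cover:
  assumes s: "prepared s" and x: "digits_in x (arr s ''dg'')"
  shows "wp W cover (\<lambda>t s'. t \<le> 8 * (n + 1) ^ 2 \<and>
    (\<forall>i<n. arr s' ''xc'' (int i) = of_bool (cov x i))) s"
proof -
  let ?T = "n * (2 + 2) + 2 + 1"
  have t: "n * (?T + 2) + 2 \<le> 8 * (n + 1) ^ 2"
    by (rule loop_time'[where a = 1 and K = 4 and e = 1]) simp_all
  have clq: "arr s ''clq'' (int w) = int (cl w)" and dg: "arr s ''dg'' (int w) = int (x w)" if "w < n" for w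
    using s x that clq_inD digits_inD[of x _ w] by auto
  note s = preparedD[OF s]
  show ?thesis
    unfolding cover_def
  proof (rule wp_mono[OF wp_For[where m = n and T = ?T and
        I = "\<lambda>i s'. \<forall>v<i. arr s' ''xc'' (int v) = of_bool (cov x v)"]], goal_cases)
    case (5 i s')
    note s1 = 5
    have r: "reg s' ''i'' = int i" "arr s' ''clq'' = arr s ''clq''" "arr s' ''dg'' = arr s ''dg''"
      "ready s'" "reg s' ''n'' = int n"
      using s1 s by (simp_all add: frame_def)
    let ?J = "\<lambda>m s2. arr s2 ''xc'' (int i) = of_bool (\<exists>w<m. cl w = 0 \<and> x w = 0 \<and> A i w) \<and>
            (\<forall>v<i. arr s2 ''xc'' (int v) = of_bool (cov x v))"
    show ?case unfolding wp_Seq wp_Store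
    proof (intro conjI, goal_cases)
      case 5
      show ?case
      proof (rule wp_mono[OF wp_For[where m = n and T = 2 and I = ?J]], goal_cases)
        case (5 w s2)
        have "reg s2 ''i'' = int i" "arr s2 ''clq'' = arr s ''clq''" "arr s2 ''dg'' = arr s ''dg''" "ready s2"
          using 5 r by (simp_all add: frame_def)
        then show ?case using 5 s1(1) clq[of w] dg[of w] W_small by (auto simp: less_Suc_eq)
      next
        case (6 t s2)
        then show ?case by (auto simp: less_Suc_eq cov_def)
      qed (use r s1 W_small in \<open>auto simp: frame_def\<close>)
    qed (use r s1 W_small in simp_all)
  qed (use s W_small t in \<open>auto simp: frame_def\<close>)
qed

lemma skip_less: "w < n \<Longrightarrow> skip x w = x w"
  by (simp add: skip_def)

text \<open>\<open>advance\<close> moves the position before it tries a pick, so \<open>dg\<close>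
  holds \<open>skip x\<close> when the covering is computed.\<close>

lemma cov_skip: "cov (skip x) = cov x"
  by (auto simp: cov_def fun_eq_iff skip_less)

definition clique_gain :: com where
  "clique_gain = ''g'' ::= Const 0 ;;
     Cond (BAnd (Less (Const 0) (Var ''j'')) (Eq (Read ''dg'' (Var ''n'')) (Const 0)))
       (For ''i'' (Var ''n'')
         (Cond (BAnd (Eq (Read ''blue'' (Var ''i'')) (Const 1))
               (BAnd (Eq (Read ''clq'' (Var ''i'')) (Var ''j'')) (Eq (Read ''xc'' (Var ''i'')) (Const 0))))
           (''g'' ::= Add (Var ''g'') (Const 1)) Skip))
       Skip"

lemma wp_clique_gain:
  assumes s: "prepared s" and x: "digits_in (skip x) (arr s ''dg'')" and j: "reg s ''j'' = int (x (n + 4))"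
    and xc: "\<And>i. i < n \<Longrightarrow> arr s ''xc'' (int i) = of_bool (cov x i)"
  shows "wp W clique_gain (\<lambda>t s'. t \<le> 4 * (n + 1) \<and>
    reg s' ''g'' = int (if 0 < x (n + 4) \<and> x n = 0 then gain x else 0)) s"
proof -
  note s = preparedD[OF s]
  have dg: "arr s ''dg'' (int n) = int (x n)" using digits_inD[OF x, of n] by (simp add: skip_def)
  have "wp W (For ''i'' (Var ''n'')
         (Cond (BAnd (Eq (Read ''blue'' (Var ''i'')) (Const 1))
               (BAnd (Eq (Read ''clq'' (Var ''i'')) (Var ''j'')) (Eq (Read ''xc'' (Var ''i'')) (Const 0))))
           (''g'' ::= Add (Var ''g'') (Const 1)) Skip))
       (\<lambda>t s'. t \<le> n * 4 + 2 \<and> reg s' ''g'' = int (card {i. i < n \<and> (i \<in> B \<and> cl i = x (n + 4) \<and> \<not> cov x i)}))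
       (s\<lparr>reg := (reg s)(''g'' := 0)\<rparr>)"
  proof (rule wp_count, goal_cases)
    case (6 i s')
    then have "arr s' ''blue'' (int i) = of_bool (i \<in> B)" "arr s' ''clq'' (int i) = int (cl i)"
      "arr s' ''xc'' (int i) = of_bool (cov x i)" "reg s' ''j'' = int (x (n + 4))"
      using j xc ready_colour(2)[OF s(1)] clq_inD[OF s(3)] by (simp_all add: frame_def)
    with 6 W_small show ?case by simp
  qed (use s in simp_all)
  then show ?thesis
    unfolding clique_gain_def using s dg j W_small by (auto simp: gain_def elim!: wp_mono)
qed

definition lower_nbrs :: com where
  "lower_nbrs = For ''i'' (Var ''n'')
     (Cond (BAnd (Eq (Read ''dg'' (Var ''i'')) (Const 2)) (Eq (edge (Var ''i'') (Var ''v'')) (Const 1)))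
       (Store ''dg'' (Var ''i'') (Const 1)) Skip)"

lemma wp_lower_nbrs:
  assumes s: "ready s" and v: "reg s ''v'' = int v" "v < n"
  shows "wp W lower_nbrs (\<lambda>t s'. t \<le> n * (2 + 2) + 2 \<and> (\<forall>i. arr s' ''dg'' (int i) =
    (if i < n \<and> arr s ''dg'' (int i) = 2 \<and> A i v then 1 else arr s ''dg'' (int i)))) s"
proof -
  note s = s ready_n[OF s]
  show ?thesis
    unfolding lower_nbrs_def
  proof (rule wp_For[where m = n and T = 2 and I = "\<lambda>m s'. \<forall>i. arr s' ''dg'' (int i) =
    (if i < m \<and> arr s ''dg'' (int i) = 2 \<and> A i v then 1 else arr s ''dg'' (int i))"], goal_cases)
    case (5 i s')
    have "ready s'" "reg s' ''v'' = int v" using 5 s v by (simp_all add: frame_def)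
    with 5 v W_small show ?case by (auto simp: less_Suc_eq)
  qed (use s W_small in \<open>simp_all add: frame_def\<close>)
qed

text \<open>The order matters: covering and gain are computed while \<open>dg\<close> still has the
  old modulator digits and the old hit flag, which is set afterwards. The picked vertex is not its
  own neighbour, so its digit is written separately.\<close>

definition select :: com where
  "select = cover ;; clique_gain ;;
     Store ''dg'' (Add (Var ''n'') (Const 2)) (Add (Read ''dg'' (Add (Var ''n'') (Const 2))) (Var ''g'')) ;;
     Store ''dg'' (Var ''n'') (Const 1) ;;
     Store ''dg'' (Add (Var ''n'') (Const 1)) (Add (Read ''dg'' (Add (Var ''n'') (Const 1))) (Const 1)) ;;
     lower_nbrs ;;
     Store ''dg'' (Var ''v'') (Const 0) ;;
     mark"

lemma written [simp]:
  "written_regs cover = {''i'', ''w''}" "written_arrs cover = {''xc''}"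
  "written_regs clique_gain = {''g'', ''i''}" "written_arrs clique_gain = {}"
  "written_regs lower_nbrs = {''i''}" "written_arrs lower_nbrs = {''dg''}"
  "written_regs mark = {''e'', ''i'', ''r''}" "written_arrs mark = {''tab''}"
  by (auto simp: cover_def clique_gain_def lower_nbrs_def mark_def)

lemma wp_select:
  assumes s: "prepared s" and x: "digits_in (skip x) (arr s ''dg'')" "x \<in> summaries"
    and v: "reg s ''v'' = int (x (n + 3))" "x (n + 3) < n" "x (n + 3) \<in> R"
    and j: "reg s ''j'' = int (x (n + 4))" "cl (x (n + 3)) = x (n + 4)" "x (n + 4) \<le> n"
  shows "wp W select (\<lambda>t s'. t \<le> 110 * (n + 1) ^ 2 \<and>
    arr s' ''tab'' = (arr s ''tab'')(int (code (n + 5) (pick x)) := 1)) s"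
proof -
  note p = preparedD[OF s]
  have pick: "pick x \<in> summaries"
    using succs_summaries[OF x(2)] v j by (simp add: succs_def)
  note rad = summaries_less_radix[OF pick]
  define g where "g = (if 0 < x (n + 4) \<and> x n = 0 then gain x else 0)"
  \<comment> \<open>\<open>pick x\<close> summarises an actual set, so its counters respect their
    radices and the two sums fit into a word.\<close>
  have bounds: "x (n + 2) + g < n + 2" "x (n + 1) + 1 < n + 2"
    using rad[of "n + 2"] rad[of "n + 1"] by (simp_all add: pick_def radix_def g_def)
  have dg: "arr s ''dg'' (int i) = int (skip x i)" if "i < n + 5" for i
    using digits_inD[OF x(1) that] .
  have dg12: "arr s ''dg'' (int n + 1) = int (x (n + 1))" "arr s ''dg'' (int n + 2) = int (x (n + 2))"
    using dg[of "n + 1"] dg[of "n + 2"] by (simp_all add: skip_def add.commute)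
  show ?thesis
    unfolding select_def wp_Seq[of _ cover]
  proof (rule wp_frame[OF wp_cover[OF s x(1)]], goal_cases)
    case (1 t1 s1)
    then have time1: "t1 \<le> 8 * (n + 1) ^ 2" by blast
    have p1: "prepared s1" "arr s1 ''dg'' = arr s ''dg''" "reg s1 ''j'' = int (x (n + 4))"
      "reg s1 ''v'' = int (x (n + 3))" "arr s1 ''tab'' = arr s ''tab''"
      using p v j 1(2) by (simp_all add: frame_def)
    have xc: "arr s1 ''xc'' (int i) = of_bool (cov x i)" if "i < n" for i
      using 1(1) that by (simp add: cov_skip)
    show ?case unfolding wp_Seq[of _ clique_gain]
    proof (rule wp_frame[OF wp_clique_gain[OF p1(1) _ p1(3) xc]], goal_cases)
      case (3 t2 s2)
      have p2: "prepared s2" "arr s2 ''dg'' = arr s ''dg''"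
        "reg s2 ''v'' = int (x (n + 3))" "arr s2 ''tab'' = arr s ''tab''" "reg s2 ''g'' = int g"
        using preparedD[OF p1(1)] p1 3 by (simp_all add: frame_def g_def)
      define f where "f = (arr s ''dg'')(int n + 2 := int (x (n + 2) + g), int n := 1, int n + 1 := int (x (n + 1) + 1))"
      define s3 where "s3 = s2\<lparr>arr := (arr s2)(''dg'' := f)\<rparr>"
      have "ready s3" "reg s3 ''v'' = int (x (n + 3))" using preparedD[OF p2(1)] p2 by (simp_all add: s3_def)
      note lower = wp_lower_nbrs[OF this v(2)]
      have rest: "wp W (lower_nbrs ;; Store ''dg'' (Var ''v'') (Const 0) ;; mark)
        (\<lambda>t s'. t1 + (t2 + (1 + (1 + (1 + t)))) \<le> 110 * (n + 1) ^ 2 \<and>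
          arr s' ''tab'' = (arr s ''tab'')(int (code (n + 5) (pick x)) := 1)) s3"
        unfolding wp_Seq[of _ lower_nbrs]
      proof (rule wp_frame[OF lower], goal_cases)
        case (1 t4 s4)
        define s5 where "s5 = s4\<lparr>arr := (arr s4)(''dg'' := (arr s4 ''dg'')(int (x (n + 3)) := 0))\<rparr>"
        have p5: "prepared s5" "arr s5 ''tab'' = arr s ''tab''" "reg s4 ''v'' = int (x (n + 3))"
          using preparedD[OF p2(1)] p2 1(2) by (simp_all add: frame_def s5_def s3_def)
        have low: "arr s5 ''dg'' (int i) = (if i = x (n + 3) then 0
            else if i < n \<and> f (int i) = 2 \<and> A i (x (n + 3)) then 1 else f (int i))" for i
          using 1(1) by (simp add: s5_def s3_def)
        have f: "f (int i) = int (x i)" if "i < n" for i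
          using dg[of i] that by (simp add: f_def skip_def)
        have fn: "f (int n) = 1" "f (int n + 1) = int (x (n + 1) + 1)" "f (int n + 2) = int (x (n + 2) + g)"
          "f (int n + 3) = int (x (n + 3) + 1)" "f (int n + 4) = int (x (n + 4))"
          using dg[of "n + 3"] dg[of "n + 4"] by (simp_all add: f_def skip_def add.commute)
        have "arr s5 ''dg'' (int i) = int (pick x i)" if "i < n + 5" for i
        proof -
          from that have "i < n \<or> i = n \<or> i = n + 1 \<or> i = n + 2 \<or> i = n + 3 \<or> i = n + 4" by linarith
          then show ?thesis
            unfolding low using f[of i] fn v(2) by (elim disjE) (simp_all add: pick_def g_def add.commute)
        qed
        then have dg5: "digits_in (pick x) (arr s5 ''dg'')" by (simp add: digits_in_def)
        have "t1 \<le> 8 * (n + 1) ^ 2" "t2 \<le> 4 * (n + 1) ^ 2" "t4 + 4 \<le> 10 * (n + 1) ^ 2"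
          using time1 3(1) 1(1) power_time[of t2 4 "n + 1" 1 2] power_time[of "t4 + 4" 10 "n + 1" 1 2] by simp_all
        then show ?case
          unfolding wp_Seq[of _ "Store a b c" for a b c] wp_Store
          using preparedD[OF p5(1)] p5 v W_small
          by (auto simp flip: s5_def intro!: wp_mono[OF wp_mark[OF p5(1) dg5 rad]])
      qed
      have "int (x (n + 2) + g) \<le> W" "int (x (n + 1) + 1) \<le> W" using bounds W_small by linarith+
      then show ?case
        unfolding wp_Seq[of _ "Store a b c" for a b c] wp_Store
        using preparedD[OF p2(1)] p2 dg12 W_small rest
        by (simp add: s3_def f_def add.commute)
    qed (use x p1 in \<open>simp_all only:\<close>)
  qed
qed

definition turn_group :: com where
  "turn_group = Store ''dg'' (Var ''n'') (Const 0) ;;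
     Store ''dg'' (Add (Var ''n'') (Const 3)) (Const 0) ;;
     Store ''dg'' (Add (Var ''n'') (Const 4)) (Add (Var ''j'') (Const 1)) ;; mark"

definition advance :: com where
  "advance = Store ''dg'' (Add (Var ''n'') (Const 3)) (Add (Var ''v'') (Const 1)) ;; mark ;;
     Cond (BAnd (Eq (Read ''red'' (Var ''v'')) (Const 1)) (Eq (Read ''clq'' (Var ''v'')) (Var ''j''))) select Skip"

definition finish :: com where
  "finish = cover ;; ''u'' ::= Const 0 ;;
     For ''i'' (Var ''n'')
       (Cond (BAnd (Eq (Read ''blue'' (Var ''i'')) (Const 1))
             (BAnd (BNot (BAnd (Eq (Read ''clq'' (Var ''i'')) (Const 0)) (Less (Read ''dg'' (Var ''i'')) (Const 2))))
                   (BNot (BAnd (Less (Const 0) (Read ''clq'' (Var ''i''))) (Eq (Read ''xc'' (Var ''i'')) (Const 1))))))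
         (''u'' ::= Add (Var ''u'') (Const 1)) Skip) ;;
     Cond (BAnd (BNot (Less (Var ''gamma'') (Read ''dg'' (Add (Var ''n'') (Const 1)))))
                (BNot (Less (Var ''k'') (Sub (Var ''u'') (Read ''dg'' (Add (Var ''n'') (Const 2)))))))
       (''answer'' ::= Const 1) Skip"

definition process :: com where
  "process = ''v'' ::= Read ''dg'' (Add (Var ''n'') (Const 3)) ;;
     ''j'' ::= Read ''dg'' (Add (Var ''n'') (Const 4)) ;;
     Cond (Less (Var ''n'') (Var ''j'')) finish (Cond (Less (Var ''v'') (Var ''n'')) advance turn_group)"

definition add_marks :: "(nat \<Rightarrow> nat) set \<Rightarrow> (int \<Rightarrow> int) \<Rightarrow> int \<Rightarrow> int" where
  "add_marks Y f = (\<lambda>i. if \<exists>y\<in>Y. i = int (code (n + 5) y) then 1 else f i)"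

lemma add_marks_simps:
  "add_marks {} f = f" "add_marks (insert y Y) f = (add_marks Y f)(int (code (n + 5) y) := 1)"
  by (auto simp: add_marks_def fun_eq_iff)

lemma less_n5: "i < n + 5 \<Longrightarrow> i < n \<or> i = n \<or> i = n + 1 \<or> i = n + 2 \<or> i = n + 3 \<or> i = n + 4"
  by linarith

lemma digits_in_tail:
  assumes "digits_in x f"
  shows "f (int n) = int (x n)" "f (int n + 1) = int (x (n + 1))" "f (int n + 2) = int (x (n + 2))"
    "f (int n + 3) = int (x (n + 3))" "f (int n + 4) = int (x (n + 4))"
  using digits_inD[OF assms, of n] digits_inD[OF assms, of "n + 1"] digits_inD[OF assms, of "n + 2"]
    digits_inD[OF assms, of "n + 3"] digits_inD[OF assms, of "n + 4"] by (simp_all add: add.commute)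

lemma wp_turn_group:
  assumes s: "prepared s" and x: "digits_in x (arr s ''dg'')" "turn x \<in> summaries"
    and j: "reg s ''j'' = int (x (n + 4))" "x (n + 4) \<le> n"
  shows "wp W turn_group (\<lambda>t s'. t \<le> 90 * (n + 1) ^ 2 \<and> arr s' ''tab'' = add_marks {turn x} (arr s ''tab'')) s"
proof -
  note p = preparedD[OF s]
  define f where "f = (arr s ''dg'')(int n := 0, int n + 3 := 0, int n + 4 := int (x (n + 4) + 1))"
  define s1 where "s1 = s\<lparr>arr := (arr s)(''dg'' := f)\<rparr>"
  have p1: "prepared s1" using p by (simp add: s1_def)
  have "f (int i) = int (turn x i)" if "i < n + 5" for i
    using less_n5[OF that] digits_inD[OF x(1) that] digits_in_tail[OF x(1)]
    by (elim disjE) (simp_all add: f_def turn_def)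
  then have dg: "digits_in (turn x) (arr s1 ''dg'')" by (simp add: s1_def digits_in_def)
  have one: "1 + (1 + (1 + t)) \<le> 90 * (n + 1) ^ 2" if "t \<le> 80 * (n + 1) ^ 2" for t
    using that one_le_power[of "n + 1" 2] by linarith
  have "wp W mark (\<lambda>t s'. 1 + (1 + (1 + t)) \<le> 90 * (n + 1) ^ 2 \<and>
      arr s' ''tab'' = add_marks {turn x} (arr s ''tab'')) s1"
    using one by (intro wp_mono[OF wp_mark[OF p1 dg summaries_less_radix[OF x(2)]]])
      (simp add: add_marks_simps s1_def)
  then show ?thesis
    unfolding turn_group_def wp_Seq[of _ "Store a b c" for a b c] wp_Store
    using p j W_small by (simp add: s1_def f_def add.commute)
qed

lemma wp_advance:
  assumes s: "prepared s" and x: "digits_in x (arr s ''dg'')" "x \<in> summaries"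
    and v: "reg s ''v'' = int (x (n + 3))" "x (n + 3) < n"
    and j: "reg s ''j'' = int (x (n + 4))" "x (n + 4) \<le> n"
  shows "wp W advance (\<lambda>t s'. t \<le> 200 * (n + 1) ^ 2 \<and> arr s' ''tab'' = add_marks (succs x) (arr s ''tab'')) s"
proof -
  note p = preparedD[OF s]
  define s1 where "s1 = s\<lparr>arr := (arr s)(''dg'' := (arr s ''dg'')(int n + 3 := int (x (n + 3) + 1)))\<rparr>"
  have p1: "prepared s1" using p by (simp add: s1_def)
  have "arr s1 ''dg'' (int i) = int (skip x i)" if "i < n + 5" for i
    using less_n5[OF that] digits_inD[OF x(1) that] digits_in_tail[OF x(1)]
    by (elim disjE) (simp_all add: s1_def skip_def)
  then have dg: "digits_in (skip x) (arr s1 ''dg'')" by (simp add: digits_in_def)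
  have skip: "skip x \<in> summaries"
    using succs_summaries[OF x(2)] v j by (simp add: succs_def)
  have time: "1 + (t + (u + 1)) \<le> 200 * (n + 1) ^ 2" if "t \<le> 80 * (n + 1) ^ 2" "u \<le> 110 * (n + 1) ^ 2" for t u
    using that one_le_power[of "n + 1" 2] by linarith
  have "wp W (mark ;; Cond (BAnd (Eq (Read ''red'' (Var ''v'')) (Const 1)) (Eq (Read ''clq'' (Var ''v'')) (Var ''j''))) select Skip)
    (\<lambda>t s'. 1 + t \<le> 200 * (n + 1) ^ 2 \<and> arr s' ''tab'' = add_marks (succs x) (arr s ''tab'')) s1"
    unfolding wp_Seq
  proof (rule wp_frame[OF wp_mark[OF p1 dg summaries_less_radix[OF skip]]], goal_cases)
    case (1 t s2)
    have p2: "prepared s2" "reg s2 ''v'' = int (x (n + 3))" "reg s2 ''j'' = int (x (n + 4))"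
      "arr s2 ''dg'' = arr s1 ''dg''"
      using 1(2) p v j by (simp_all add: frame_def s1_def)
    have tab: "arr s2 ''tab'' = (arr s ''tab'')(int (code (n + 5) (skip x)) := 1)"
      using 1(1) by (simp add: s1_def)
    have rd: "arr s2 ''red'' (int (x (n + 3))) = of_bool (x (n + 3) \<in> R)"
      using ready_colour(1) p2(1) v(2) by blast
    have cq: "arr s2 ''clq'' (int (x (n + 3))) = int (cl (x (n + 3)))"
      using clq_inD p2(1) v(2) by blast
    have vW: "int (x (n + 3)) \<le> W" using v(2) W_small by linarith
    show ?case
    proof (cases "x (n + 3) \<in> R \<and> cl (x (n + 3)) = x (n + 4)")
      case True
      have succs: "succs x = insert (pick x) {skip x}" using True v j by (auto simp: succs_def)
      have "wp W select (\<lambda>u s'. 1 + (t + (u + 1)) \<le> 200 * (n + 1) ^ 2 \<and>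
         arr s' ''tab'' = add_marks (succs x) (arr s ''tab'')) s2"
        using wp_select[OF p2(1) dg[folded p2(4)] x(2) p2(2) v(2) conjunct1[OF True] p2(3) conjunct2[OF True] j(2)]
      proof (rule wp_mono, goal_cases)
        case (1 u s3)
        then show ?case using time[of t u] \<open>t \<le> 80 * (n + 1) ^ 2 \<and> _\<close>
          by (simp add: succs add_marks_simps tab)
      qed
      then show ?thesis using True p2 rd cq vW by simp
    next
      case False
      have succs: "succs x = {skip x}" using False v j by (auto simp: succs_def)
      show ?thesis using False p2 rd cq vW 1 time[of t 1] by (auto simp: succs add_marks_simps tab)
    qed
  qed
  then show ?thesis
    unfolding advance_def wp_Seq[of _ "Store a b c" for a b c] wp_Store
    using p v W_small by (simp add: s1_def add.commute)
qed

lemma wp_finish: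
  assumes s: "prepared s" and x: "digits_in x (arr s ''dg'')" "x (n + 4) = n + 1"
    and k: "reg s ''k'' = k" "reg s ''gamma'' = \<gamma>"
  shows "wp W finish (\<lambda>t s'. t \<le> 20 * (n + 1) ^ 2 \<and> arr s' ''tab'' = arr s ''tab'' \<and>
    reg s' ''answer'' = (if accepts k \<gamma> x then 1 else reg s ''answer'')) s"
  unfolding finish_def wp_Seq[of _ cover]
proof (rule wp_frame[OF wp_cover[OF s x(1)]], goal_cases)
  case (1 t s1)
  note p = preparedD[OF s]
  have p1: "ready s1" "reg s1 ''n'' = int n" "clq_in (arr s1 ''clq'')" "arr s1 ''dg'' = arr s ''dg''"
    "reg s1 ''k'' = k" "reg s1 ''gamma'' = \<gamma>" "reg s1 ''answer'' = reg s ''answer''" "arr s1 ''tab'' = arr s ''tab''"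
    using 1(2) p k by (simp_all add: frame_def)
  have xc: "arr s1 ''xc'' (int i) = of_bool (cov x i)" if "i < n" for i using 1(1) that by blast
  have dg: "arr s ''dg'' (int i) = int (x i)" if "i < n" for i using digits_inD[OF x(1)] that by simp
  show ?case unfolding wp_Seq wp_Assign
  proof (intro conjI, goal_cases)
    case 3
    show ?case
    proof (rule wp_frame[OF wp_count[where P = "\<lambda>i. i \<in> B \<and> \<not> (cl i = 0 \<and> x i < 2) \<and> \<not> (cl i \<noteq> 0 \<and> cov x i)"]], goal_cases)
      case (6 i s2)
      then have "arr s2 ''blue'' (int i) = of_bool (i \<in> B)" "arr s2 ''clq'' (int i) = int (cl i)"
        "arr s2 ''xc'' (int i) = of_bool (cov x i)" "arr s2 ''dg'' (int i) = int (x i)"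
        using p1 dg xc ready_colour(2)[OF p1(1)] clq_inD[OF p1(3)] by (simp_all add: frame_def)
      with 6 W_small show ?case by auto
    next
      case (7 u s2)
      have u: "reg s2 ''u'' = int (card (missed x))" using 7(1) by (simp add: missed_def)
      have r: "reg s2 ''n'' = int n" "arr s2 ''dg'' = arr s ''dg''" "reg s2 ''k'' = k" "reg s2 ''gamma'' = \<gamma>"
        "reg s2 ''answer'' = reg s ''answer''" "arr s2 ''tab'' = arr s ''tab''"
        using 7(2) p1 by (simp_all add: frame_def)
      have time: "t + (1 + (u + (1 + 1))) \<le> 20 * (n + 1) ^ 2"
        using 1(1) 7(1) power_time[of "u + 3" 5 "n + 1" 1 2] by simp
      show ?case
        using u r time digits_in_tail[OF x(1)] W_small x(2)
        by (auto simp: accepts_def)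
    qed (use p1 in simp_all)
  qed (use W_small in simp_all)
qed

lemma wp_process:
  assumes s: "prepared s" and x: "digits_in x (arr s ''dg'')" "x \<in> summaries"
    and k: "reg s ''k'' = k" "reg s ''gamma'' = \<gamma>"
  shows "wp W process (\<lambda>t s'. t \<le> 210 * (n + 1) ^ 2 \<and>
    arr s' ''tab'' = add_marks (succs x) (arr s ''tab'') \<and>
    reg s' ''answer'' = (if accepts k \<gamma> x then 1 else reg s ''answer'')) s"
proof -
  note p = preparedD[OF s]
  define s1 where "s1 = s\<lparr>reg := (reg s)(''v'' := int (x (n + 3)), ''j'' := int (x (n + 4)))\<rparr>"
  have p1: "prepared s1" "digits_in x (arr s1 ''dg'')" "reg s1 ''v'' = int (x (n + 3))"
    "reg s1 ''j'' = int (x (n + 4))" "reg s1 ''k'' = k" "reg s1 ''gamma'' = \<gamma>" "arr s1 ''tab'' = arr s ''tab''"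
    "reg s1 ''answer'' = reg s ''answer''"
    using p x(1) k by (simp_all add: s1_def)
  have rad: "x (n + 3) < n + 2" "x (n + 4) < n + 2"
    using summaries_less_radix[OF x(2), of "n + 3"] summaries_less_radix[OF x(2), of "n + 4"]
    by (simp_all add: radix_def)
  \<comment> \<open>Only \<open>finish\<close> can set the answer, and it runs exactly at the final
    position, the only one where \<open>accepts\<close> can hold.\<close>
  have wr: "''answer'' \<notin> written_regs advance" "''answer'' \<notin> written_regs turn_group"
    by (simp_all add: advance_def turn_group_def select_def)
  have time: "1 + (1 + (t + 1 + 1)) \<le> 210 * (n + 1) ^ 2" "1 + (1 + (t + 1)) \<le> 210 * (n + 1) ^ 2" if "t \<le> 200 * (n + 1) ^ 2" for t
    using that one_le_power[of "n + 1" 2] by linarith+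
  have "wp W (Cond (Less (Var ''n'') (Var ''j'')) finish (Cond (Less (Var ''v'') (Var ''n'')) advance turn_group))
    (\<lambda>t s'. 1 + (1 + t) \<le> 210 * (n + 1) ^ 2 \<and>
      arr s' ''tab'' = add_marks (succs x) (arr s ''tab'') \<and>
      reg s' ''answer'' = (if accepts k \<gamma> x then 1 else reg s ''answer'')) s1"
  proof (cases "x (n + 4) \<le> n")
    case False
    then have j: "x (n + 4) = n + 1" using rad by simp
    then have "succs x = {}" by (simp add: succs_def)
    with j p1 show ?thesis
      using time(2) by (fastforce simp: add_marks_simps intro!: wp_mono[OF wp_finish[OF p1(1,2) j p1(5,6)]])
  next
    case j: True
    then have acc: "\<not> accepts k \<gamma> x" by (simp add: accepts_def)
    show ?thesis
    proof (cases "x (n + 3) < n")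
      case True
      have "wp W advance (\<lambda>t s'. 1 + (1 + (t + 1 + 1)) \<le> 210 * (n + 1) ^ 2 \<and>
          arr s' ''tab'' = add_marks (succs x) (arr s ''tab'') \<and> reg s' ''answer'' = reg s ''answer'') s1"
        by (rule wp_frame[OF wp_advance[OF p1(1,2) x(2) p1(3) True p1(4) j]])
          (use time p1 wr in \<open>auto simp: frame_def\<close>)
      then show ?thesis using True j p1 acc by simp
    next
      case False
      then have succs: "succs x = {turn x}" using j by (simp add: succs_def)
      then have "turn x \<in> summaries" using succs_summaries[OF x(2)] by simp
      from wp_turn_group[OF p1(1,2) this p1(4) j]
      have "wp W turn_group (\<lambda>t s'. 1 + (1 + (t + 1 + 1)) \<le> 210 * (n + 1) ^ 2 \<and>
          arr s' ''tab'' = add_marks (succs x) (arr s ''tab'') \<and> reg s' ''answer'' = reg s ''answer'') s1"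
        by (rule wp_frame) (use time p1 wr in \<open>auto simp: frame_def succs\<close>)
      then show ?thesis using False j p1 acc by simp
    qed
  qed
  then show ?thesis
    unfolding process_def wp_Seq[of _ "Assign a b" for a b] wp_Assign
    using p rad W_small digits_in_tail[OF x(1)] by (simp add: s1_def add.commute)
qed

section \<open>Invariant of the marking pass\<close>

lemma code_inj:
  assumes "x \<in> summaries" "y \<in> summaries" "code (n + 5) x = code (n + 5) y"
  shows "x = y"
proof
  fix i
  show "x i = y i"
  proof (cases "i < n + 5")
    case True
    then show ?thesis
      using digit_code[of "n + 5" x i] digit_code[of "n + 5" y i] summaries_less_radix assms by metis
  next
    case False
    \<comment> \<open>Beyond the last digit all summaries vanish, so equal codes give equal
      functions.\<close>
    have "x i = 0" "y i = 0" using assms(1,2) False by (auto simp: summaries_def summary_def)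
    then show ?thesis by simp
  qed
qed

text \<open>At \<open>q = 0\<close> nothing is claimed about successors; at
  \<open>q = wt (n + 5)\<close> the marked summaries are closed under them. Only codes of summaries
  carry marks, so decoding a marked cell yields a genuine summary.\<close>

definition marked :: "nat \<Rightarrow> (int \<Rightarrow> int) \<Rightarrow> bool" where
  "marked q f \<longleftrightarrow> (\<forall>i. f i \<noteq> 0 \<longrightarrow> f i = 1 \<and> (\<exists>x\<in>summaries. i = int (code (n + 5) x)))
     \<and> f (int (code (n + 5) (summary {} 0 0))) = 1
     \<and> (\<forall>x\<in>summaries. code (n + 5) x < q \<longrightarrow> f (int (code (n + 5) x)) = 1 \<longrightarrow>
          (\<forall>y\<in>succs x. f (int (code (n + 5) y)) = 1))"

definition accepted :: "int \<Rightarrow> int \<Rightarrow> nat \<Rightarrow> (int \<Rightarrow> int) \<Rightarrow> bool" where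
  "accepted k \<gamma> q f \<longleftrightarrow> (\<exists>x\<in>summaries. code (n + 5) x < q \<and> f (int (code (n + 5) x)) = 1 \<and> accepts k \<gamma> x)"

lemma summary_empty: "summary {} 0 0 \<in> summaries"
  unfolding summaries_def by blast

lemma marked_init: "marked 0 ((\<lambda>_. 0)(int (code (n + 5) (summary {} 0 0)) := 1))"
  using summary_empty by (auto simp: marked_def)

lemma marked_skip:
  assumes "marked q f" "f (int q) \<noteq> 1"
  shows "marked (Suc q) f" "accepted k \<gamma> (Suc q) f = accepted k \<gamma> q f"
proof -
  have less: "code (n + 5) x < q" if "code (n + 5) x < Suc q" "f (int (code (n + 5) x)) = 1" for x
    using that assms(2) by (cases "code (n + 5) x = q") simp_all
  then show "marked (Suc q) f" using assms(1) unfolding marked_def by blast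
  show "accepted k \<gamma> (Suc q) f = accepted k \<gamma> q f"
    using less less_SucI unfolding accepted_def by blast
qed

text \<open>Successors have codes above \<open>q\<close>, so new marks never appear at a cell
  already passed, and a single pass is enough. Injectivity of the code identifies the summary
  handled at \<open>q\<close> with \<open>x\<close>.\<close>

lemma marked_process:
  assumes m: "marked q f" and x: "x \<in> summaries" "code (n + 5) x = q" "f (int q) = 1"
  shows "marked (Suc q) (add_marks (succs x) f)"
    and "accepted k \<gamma> (Suc q) (add_marks (succs x) f) \<longleftrightarrow> accepts k \<gamma> x \<or> accepted k \<gamma> q f"
proof -
  have later: "q < code (n + 5) y" if "y \<in> succs x" for y
    using code_less_succs[OF x(1) that] x(2) by simp
  then have old: "add_marks (succs x) f (int (code (n + 5) z)) = f (int (code (n + 5) z))"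
    if "code (n + 5) z \<le> q" for z
    using that by (fastforce simp: add_marks_def)
  have mono: "add_marks (succs x) f i = 1" if "f i = 1" for i
    using that by (simp add: add_marks_def)
  have new: "add_marks (succs x) f (int (code (n + 5) y)) = 1" if "y \<in> succs x" for y
    using that by (auto simp: add_marks_def)
  have same: "z = x" if "z \<in> summaries" "code (n + 5) z = q" for z
    using code_inj[OF that(1) x(1)] that x by simp
  have "add_marks (succs x) f i = 1 \<and> (\<exists>x\<in>summaries. i = int (code (n + 5) x))"
    if "add_marks (succs x) f i \<noteq> 0" for i
    using that m succs_summaries[OF x(1)] unfolding marked_def add_marks_def by (auto split: if_splits)
  moreover have "add_marks (succs x) f (int (code (n + 5) (summary {} 0 0))) = 1"
    using m mono by (auto simp: marked_def)
  moreover have "add_marks (succs x) f (int (code (n + 5) y)) = 1"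
    if z: "z \<in> summaries" "code (n + 5) z < Suc q" "add_marks (succs x) f (int (code (n + 5) z)) = 1" "y \<in> succs z" for z y
  proof (cases "code (n + 5) z = q")
    case True
    then show ?thesis using same[OF z(1)] new z(4) by blast
  next
    case False
    then have "code (n + 5) z < q" "f (int (code (n + 5) z)) = 1" using old[of z] z(2,3) by simp_all
    with z m have "f (int (code (n + 5) y)) = 1" unfolding marked_def by blast
    then show ?thesis by (rule mono)
  qed
  ultimately show "marked (Suc q) (add_marks (succs x) f)" unfolding marked_def by blast
  show "accepted k \<gamma> (Suc q) (add_marks (succs x) f) \<longleftrightarrow> accepts k \<gamma> x \<or> accepted k \<gamma> q f"
  proof
    assume "accepted k \<gamma> (Suc q) (add_marks (succs x) f)"
    then obtain z where z: "z \<in> summaries" "code (n + 5) z \<le> q" "accepts k \<gamma> z"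
      "f (int (code (n + 5) z)) = 1"
      unfolding accepted_def less_Suc_eq_le by (metis old)
    then show "accepts k \<gamma> x \<or> accepted k \<gamma> q f"
    proof (cases "code (n + 5) z = q")
      case True
      then show ?thesis using same[OF z(1)] z(3) by simp
    next
      case False
      then have "code (n + 5) z < q" using z(2) by simp
      then show ?thesis using z unfolding accepted_def by blast
    qed
  next
    have acc: "accepted k \<gamma> (Suc q) (add_marks (succs x) f)"
      if "z \<in> summaries" "code (n + 5) z \<le> q" "accepts k \<gamma> z" "f (int (code (n + 5) z)) = 1" for z
      unfolding accepted_def less_Suc_eq_le
    proof (intro bexI conjI)
      show "add_marks (succs x) f (int (code (n + 5) z)) = 1" using that(4) by (rule mono)
    qed (use that in simp_all)
    assume "accepts k \<gamma> x \<or> accepted k \<gamma> q f"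
    then show "accepted k \<gamma> (Suc q) (add_marks (succs x) f)"
    proof
      assume "accepts k \<gamma> x"
      with x show ?thesis by (intro acc[of x]) simp_all
    next
      assume "accepted k \<gamma> q f"
      then obtain z where "z \<in> summaries" "code (n + 5) z < q" "f (int (code (n + 5) z)) = 1" "accepts k \<gamma> z"
        unfolding accepted_def by blast
      then show ?thesis by (intro acc[of z]) simp_all
    qed
  qed
qed

text \<open>After the pass the marked summaries contain the initial one and are closed under
  successors, hence they are all of them.\<close>

lemma accepted_all:
  assumes "marked (wt (n + 5)) f"
  shows "accepted k \<gamma> (wt (n + 5)) f \<longleftrightarrow> (\<exists>x\<in>summaries. accepts k \<gamma> x)"
proof -
  have less: "code (n + 5) x < wt (n + 5)" if "x \<in> summaries" for x
    using summaries_less_radix[OF that] by (intro code_less)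
  have "x \<in> {x. f (int (code (n + 5) x)) = 1}" if "x \<in> summaries" for x
  proof (rule summaries_reachable[OF _ _ that])
    show "summary {} 0 0 \<in> {x. f (int (code (n + 5) x)) = 1}" using assms by (simp add: marked_def)
  next
    fix x y assume "x \<in> {x. f (int (code (n + 5) x)) = 1}" "x \<in> summaries" "y \<in> succs x"
    then show "y \<in> {x. f (int (code (n + 5) x)) = 1}" using assms less unfolding marked_def by blast
  qed
  with less show ?thesis unfolding accepted_def by blast
qed

definition init_digits :: com where
  "init_digits = For ''i'' (Var ''len'')
     (Cond (BAnd (Less (Var ''i'') (Var ''n'')) (Eq (Read ''clq'' (Var ''i'')) (Const 0)))
       (Store ''dg'' (Var ''i'') (Const 2)) (Store ''dg'' (Var ''i'') (Const 0)))"

lemma wp_init_digits: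
  assumes s: "prepared s"
  shows "wp W init_digits (\<lambda>t s'. t \<le> 22 * (n + 1) \<and> digits_in (summary {} 0 0) (arr s' ''dg'')) s"
proof -
  note p = preparedD[OF s]
  have len: "reg s ''len'' = int (n + 5)" using p(4) wt_inD(2) by blast
  have eq: "summary {} 0 0 i = (if i < n \<and> cl i = 0 then 2 else 0)" for i
    by (simp add: summary_def)
  show ?thesis
    unfolding init_digits_def
  proof (rule wp_mono[OF wp_For[where m = "n + 5" and T = 2 and
        I = "\<lambda>m s'. \<forall>i<m. arr s' ''dg'' (int i) = int (summary {} 0 0 i)"]], goal_cases)
    case (5 i s')
    have "i < n \<Longrightarrow> arr s ''clq'' (int i) = int (cl i)" using clq_inD p(3) by blast
    with 5 p W_small show ?case by (auto simp: frame_def eq less_Suc_eq)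
  next
    case (6 t s')
    then show ?case by (simp add: digits_in_def)
  qed (use W_small len in \<open>simp_all add: frame_def\<close>)
qed

definition dp :: com where
  "dp = weights ;; init_digits ;; mark ;;
     For ''q'' (Var ''size'') (Cond (Eq (Read ''tab'' (Var ''q'')) (Const 1)) (decode ;; process) Skip)"

lemma written_dp [simp]:
  "written_regs decode = {''e'', ''i'', ''idx''}" "written_arrs decode = {''dg''}"
  "written_regs process = {''v'', ''j'', ''i'', ''w'', ''u'', ''answer'', ''e'', ''r'', ''g''}"
  "written_arrs process = {''xc'', ''dg'', ''tab''}"
  "written_regs weights = {''len'', ''acc'', ''i'', ''radix'', ''tmp'', ''r'', ''size''}" "written_arrs weights = {''wt''}"
  "written_regs init_digits = {''i''}" "written_arrs init_digits = {''dg''}"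
  by (auto simp: decode_def process_def finish_def advance_def turn_group_def select_def weights_def init_digits_def)

lemma wp_dp:
  assumes s: "ready s" "clq_in (arr s ''clq'')" and tab: "arr s ''tab'' = (\<lambda>_. 0)"
    and k: "reg s ''k'' = k" "reg s ''gamma'' = \<gamma>" and ans: "reg s ''answer'' = 0"
  shows "wp W dp (\<lambda>t s'. t \<le> (wt (n + 5) + 1) * (400 * (n + 1) ^ 2) \<and>
    reg s' ''answer'' = of_bool (\<exists>x\<in>summaries. accepts k \<gamma> x)) s"
  unfolding dp_def wp_Seq[of _ weights] wp_Seq[of _ init_digits] wp_Seq[of _ mark]
proof (rule wp_frame[OF wp_weights[OF s]], goal_cases)
  case (1 t1 s1)
  note 11 = 1
  then have s1: "prepared s1" by blast
  show ?case
  proof (rule wp_frame[OF wp_init_digits[OF s1]], goal_cases)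
    case (1 t2 s2)
    note 12 = 1
    have s2: "prepared s2" using preparedD[OF s1] 1(2) by (simp add: frame_def)
    show ?case
    proof (rule wp_frame[OF wp_mark[OF s2 conjunct2[OF 1(1)] summaries_less_radix[OF summary_empty]]], goal_cases)
      case (1 t3 s3)
      note 13 = 1
      have s3: "prepared s3" using preparedD[OF s2] 1(2) by (simp add: frame_def)
      have size: "reg s3 ''size'' = int (wt (n + 5))" using preparedD(4)[OF s3] wt_inD(3) by blast
      have tab3: "arr s3 ''tab'' = (\<lambda>_. 0)(int (code (n + 5) (summary {} 0 0)) := 1)"
        using 11(2) 12(2) 13(1) tab by (simp add: frame_def)
      have regs: "reg s3 ''k'' = k" "reg s3 ''gamma'' = \<gamma>" "reg s3 ''answer'' = 0"
        using 11(2) 12(2) 13(2) k ans by (simp_all add: frame_def)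
      let ?I = "\<lambda>q s'. marked q (arr s' ''tab'') \<and> reg s' ''answer'' = of_bool (accepted k \<gamma> q (arr s' ''tab''))"
      show ?case
      \<comment> \<open>In units of \<open>(n + 1) ^ 2\<close>, decoding costs 80 and processing
        210; one more step for the test is absorbed in 291.\<close>
      proof (rule wp_mono[OF wp_For[where m = "wt (n + 5)" and T = "291 * (n + 1) ^ 2" and I = ?I]], goal_cases)
        case 2
        show ?case by (rule W_wt)
      next
        case (3 s')
        then show ?case using size by (simp add: frame_def)
      next
        case 4
        show ?case using marked_init regs by (simp add: tab3 accepted_def)
      next
        case (5 q s4)
        have s4: "prepared s4" "reg s4 ''k'' = k" "reg s4 ''gamma'' = \<gamma>"
          using preparedD[OF s3] regs 5(2) by (simp_all add: frame_def)
        have qW: "int q \<le> W" using 5(1) W_wt by linarith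
        show ?case
        proof (cases "arr s4 ''tab'' (int q) = 1")
          case False
          moreover have "1 + 1 \<le> 291 * (n + 1) ^ 2" using one_le_power[of "n + 1" 2] by linarith
          ultimately show ?thesis using 5 qW marked_skip[of q "arr s4 ''tab''"] by simp
        next
          case True
          then obtain x where x: "x \<in> summaries" "code (n + 5) x = q"
            using 5(4) unfolding marked_def by (metis of_nat_eq_iff zero_neq_one)
          have digit: "digit q i = x i" if "i < n + 5" for i
            using digit_code[of "n + 5" x i] summaries_less_radix[OF x(1)] x(2) that by simp
          have "wp W (decode ;; process) (\<lambda>t s'. t + 1 \<le> 291 * (n + 1) ^ 2 \<and>
              ?I (Suc q) (s'\<lparr>reg := (reg s')(''q'' := int (Suc q))\<rparr>)) s4"
            unfolding wp_Seq
          proof (rule wp_frame[OF wp_decode[OF s4(1) 5(3,1)]], goal_cases)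
            case (1 t5 s5)
            have s5: "prepared s5" "reg s5 ''k'' = k" "reg s5 ''gamma'' = \<gamma>"
              using preparedD[OF s4(1)] s4 1(2) by (simp_all add: frame_def)
            have x5: "digits_in x (arr s5 ''dg'')" using 1(1) digit by (simp add: digits_in_def)
            have tab5: "arr s5 ''tab'' = arr s4 ''tab''" "reg s5 ''answer'' = reg s4 ''answer''"
              using 1(2) by (simp_all add: frame_def)
            show ?case
            proof (rule wp_mono[OF wp_process[OF s5(1) x5 x(1) s5(2,3)]], goal_cases)
              case (1 t6 s6)
              have "t5 + t6 + 1 \<le> 291 * (n + 1) ^ 2"
                using 1 \<open>t5 \<le> _ \<and> _\<close> one_le_power[of "n + 1" 2] by linarith
              then show ?case
                using 1 tab5 5(4) marked_process[OF conjunct1[OF 5(4)] x True] by simp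
            qed
          qed
          then show ?thesis using True qW 5(3) by simp
        qed
      next
        case (6 t4 s4)
        have "t1 + (t2 + (t3 + t4)) \<le> (wt (n + 5) + 1) * (400 * (n + 1) ^ 2)"
        proof -
          have one: "1 \<le> (n + 1) ^ 2" by simp
          have "wt (n + 5) * (291 * (n + 1) ^ 2 + 2) \<le> wt (n + 5) * (400 * (n + 1) ^ 2)"
            using one by (intro mult_le_mono2) linarith
          moreover have "t1 \<le> 130 * (n + 1) ^ 2" "t2 \<le> 22 * (n + 1) ^ 2" "t3 \<le> 80 * (n + 1) ^ 2"
            using 11(1) 12(1) 13(1) power_time[of t2 22 "n + 1" 1 2] by simp_all
          moreover have "t4 \<le> wt (n + 5) * (291 * (n + 1) ^ 2 + 2) + 2" using 6 by blast
          moreover have "(wt (n + 5) + 1) * (400 * (n + 1) ^ 2) = wt (n + 5) * (400 * (n + 1) ^ 2) + 400 * (n + 1) ^ 2"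
            by simp
          ultimately show ?thesis using one by linarith
        qed
        then show ?case using 6 accepted_all by simp
      qed simp
    qed
  qed
qed

end

text \<open>The component programs do not depend on the locale parameters, so the exported constants
  take no arguments and one fixed program serves all graphs.\<close>

definition solver :: com where
  "solver = rb_input.init_rows ;; rb_input.find_modulator ;; rb_input.clique_ids ;; rb_dp.dp"

text \<open>The table has fewer than \<open>33 * 3 ^ d * (n + 1) ^ 5\<close> cells, with
  \<open>d\<close> the distance to cluster, at \<open>400 * (n + 1) ^ 2\<close> steps each: this
  gives exponent 7 and factor 13200. The earlier phases contribute 7, 200 and 12, and 14000 rounds
  the sum up.\<close>

lemma wp_solver:
  fixes G :: "nat rbgraph"
  assumes G: "rb_graph G" "verts G = {..<n}"
    and W: "int (14000 * 3 ^ dist_to_cluster G * (n + 1) ^ 7) \<le> W"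
  shows "wp W solver (\<lambda>t s. t \<le> 14000 * 3 ^ dist_to_cluster G * (n + 1) ^ 7 \<and>
    reg s ''answer'' = (if rb_reinforcement G k \<gamma> then 1 else 0)) (input_state G n k \<gamma>)"
proof -
  let ?A = "\<lambda>u v. {u, v} \<in> edges G"
  define d where "d = dist_to_cluster G"
  define Y where "Y = 3 ^ d * (n + 1) ^ 7"
  have Y: "3 ^ a * (n + 1) ^ b \<le> Y" if "a \<le> d" "b \<le> 7" for a b
    unfolding Y_def using that by (intro mult_le_mono power_increasing) auto
  have Ys: "1 \<le> Y" "n + 1 \<le> Y" "(n + 1) ^ 2 \<le> Y"
    "3 ^ d * (n + 1) \<le> Y" "3 ^ d * (n + 1) ^ 3 \<le> Y" "3 ^ d * (n + 1) ^ 5 \<le> Y"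
    using Y[of 0 0] Y[of 0 1] Y[of 0 2] Y[of d 1] Y[of d 3] Y[of d 5] by simp_all
  have YW: "14000 * int Y \<le> W" using W by (simp add: Y_def d_def algebra_simps)
  have n_Y: "n * n + n + 10 \<le> 14000 * Y" "9 * 3 ^ d * n \<le> 14000 * Y"
  proof -
    have "n * n + n \<le> (n + 1) ^ 2" by (simp add: power2_eq_square)
    moreover have "9 * 3 ^ d * n \<le> 9 * (3 ^ d * (n + 1))" by simp
    ultimately show "n * n + n + 10 \<le> 14000 * Y" "9 * 3 ^ d * n \<le> 14000 * Y"
      using Ys by linarith+
  qed
  interpret rb_input n ?A "red G" "blue G" W
    by standard (use n_Y(1) YW in \<open>simp flip: of_nat_mult of_nat_add\<close>)
  have V: "red G \<subseteq> {..<n}" "blue G \<subseteq> {..<n}" using G by (auto simp: rb_graph_def)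
  have sym: "?A u v \<Longrightarrow> ?A v u" for u v by (simp add: insert_commute)
  have irrefl: "\<not> ?A u u" for u using G(1) by (auto simp: rb_graph_def doubleton_eq_iff)
  obtain M where M: "M \<subseteq> verts G" "card M = d"
    "\<And>a b c. a < n \<Longrightarrow> b < n \<Longrightarrow> c < n \<Longrightarrow> \<not> induced_path ?A M a b c"
    using cluster_modulator[OF G(1)] unfolding G(2) d_def by auto
  have finM: "finite M" using M(1) unfolding G(2) by (rule finite_subset) simp
  let ?s = "input_state G n k \<gamma>"
  \<comment> \<open>Addressing by rows is injective on vertex pairs, so a matrix cell reflects a
    single pair.\<close>
  have adj: "(\<exists>u<n. \<exists>v<n. a * n + b = u * n + v \<and> ?A u v) \<longleftrightarrow> ?A a b" if "a < n" "b < n" for a b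
    using cell_eq that unfolding cell_def of_nat_eq_iff by blast
  have loaded: "loaded ?s"
    unfolding loaded_in_def by (simp add: input_state_def adj del: of_nat_mult of_nat_add)
  have wr: "written_regs init_rows = {''acc'', ''i''}" "written_arrs init_rows = {''row''}"
    "written_regs find_modulator = {''found'', ''a'', ''b'', ''c'', ''pa'', ''pb'', ''pc'', ''b1'', ''b2'', ''b3'', ''i'', ''base''}"
    "written_arrs find_modulator = {''node''}"
    "written_regs clique_ids = {''i'', ''w''}" "written_arrs clique_ids = {''clq''}"
    by (auto simp: init_rows_def find_modulator_def find_path_def expand_def clique_ids_def)
  show ?thesis
    unfolding solver_def wp_Seq
  proof (rule wp_frame[OF wp_init_rows[OF loaded]], goal_cases)
    case (1 t1 s1)
    note f1 = 1
    have s1: "ready s1" "reg s1 ''base'' = 0" "\<And>i. arr s1 ''node'' i = 0"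
      using 1 by (simp_all add: frame_def wr input_state_def)
    have W3: "int (9 * 3 ^ card M * n) \<le> W" using n_Y(2) YW unfolding M(2) by linarith
    show ?case
    proof (rule wp_frame[OF wp_find_modulator[OF s1 finM M(3) W3]], goal_cases)
      case (4 t2 s2)
      note f2 = 4
      obtain N where N: "N \<subseteq> {..<n}" "card N \<le> d" "\<And>a b c. a < n \<Longrightarrow> b < n \<Longrightarrow> c < n \<Longrightarrow> \<not> induced_path ?A N a b c"
        and base: "0 \<le> reg s2 ''base''" "reg s2 ''base'' + int n \<le> W"
        and node: "\<And>v. v < n \<Longrightarrow> arr s2 ''node'' (reg s2 ''base'' + int v) = of_bool (v \<in> N)"
        using 4(1) M(2) by blast
      have s2: "ready s2" using s1 4(2) by (simp add: frame_def wr)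
      let ?cl = "clique_id ?A n N"
      interpret part: cluster_partition n ?A "red G" "blue G" ?cl
        by (rule cluster_partition_clique_id[OF sym irrefl N(3)])
      have modulator: "{i. i < n \<and> ?cl i = 0} = N" using N(1) clique_id_eq_0 by auto
      have wt: "part.wt (n + 5) + 1 \<le> 33 * (3 ^ d * (n + 1) ^ 5)"
      proof -
        \<comment> \<open>From \<open>n + 2 \<le> 2 * (n + 1)\<close> comes the factor
          \<open>2 ^ 5 = 32\<close>; the summand 1 makes it 33.\<close>
        have "(n + 2) ^ 5 \<le> (2 * (n + 1)) ^ 5" by (intro power_mono) auto
        then have "(n + 2) ^ 5 \<le> 32 * (n + 1) ^ 5" by (simp only: power_mult_distrib) simp
        moreover have "(3::nat) ^ card N \<le> 3 ^ d" using N(2) by (intro power_increasing) auto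
        ultimately have "3 ^ card N * (n + 2) ^ 5 \<le> 3 ^ d * (32 * (n + 1) ^ 5)" by (intro mult_le_mono)
        moreover have "part.wt (n + 5) \<le> 3 ^ card N * (n + 2) ^ 5" using part.wt_le modulator by simp
        moreover have "1 * 1 \<le> 3 ^ d * (n + 1) ^ 5" by (intro mult_le_mono) auto
        ultimately show ?thesis by linarith
      qed
      interpret dp: rb_dp n ?A "red G" "blue G" W ?cl
        by standard (use wt Ys YW in linarith)
      show ?case
      proof (rule wp_frame[OF wp_clique_ids[OF s2 base node]], goal_cases)
        case (2 t3 s3)
        note f3 = 2
        have s3: "ready s3" "dp.clq_in (arr s3 ''clq'')"
          using s2 2 by (simp_all add: frame_def wr dp.clq_in_def)
        have in3: "arr s3 ''tab'' = (\<lambda>_. 0)" "reg s3 ''k'' = k" "reg s3 ''gamma'' = \<gamma>" "reg s3 ''answer'' = 0"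
          using f1(2) f2(2) f3(2) by (simp_all add: frame_def wr input_state_def)
        show ?case
        proof (rule wp_mono[OF dp.wp_dp[OF s3 in3]], goal_cases)
          case (1 t4 s4)
          have time: "t1 + (t2 + (t3 + t4)) \<le> 14000 * Y"
          proof -
            have "7 * (n + 1) \<le> 7 * Y" "200 * (3 ^ d * (n + 1) ^ 3) \<le> 200 * Y" "12 * (n + 1) ^ 2 \<le> 12 * Y"
              by (rule mult_le_mono2, rule Ys)+
            then have "t1 \<le> 7 * Y" "t2 \<le> 200 * Y" "t3 \<le> 12 * Y"
              using f1(1) f2(1) f3(1) unfolding M(2) mult.assoc by (meson le_trans)+
            moreover have "t4 \<le> 13200 * Y"
            proof -
              have "t4 \<le> 33 * (3 ^ d * (n + 1) ^ 5) * (400 * (n + 1) ^ 2)"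
                using 1 wt by (meson le_trans mult_le_mono1)
              also have "\<dots> = 13200 * (3 ^ d * ((n + 1) ^ 5 * (n + 1) ^ 2))" by simp
              also have "(n + 1) ^ 5 * (n + 1) ^ 2 = (n + 1) ^ 7" by (simp flip: power_add)
              finally show ?thesis unfolding Y_def .
            qed
            ultimately show ?thesis using Ys(1) by linarith
          qed
          have undom: "part.undominated D = {v \<in> blue G. closed_nbhd G v \<inter> D = {}}" for D
            using V by (auto simp: part.undominated_def closed_nbhd_def insert_commute)
          have "(\<exists>x\<in>part.summaries. part.accepts k \<gamma> x) \<longleftrightarrow> rb_reinforcement G k \<gamma>"
            unfolding part.accepts_iff rb_reinforcement_iff[OF G(1)] undom using V(1) by (simp add: Int_absorb2)
          with 1 time show ?case by (simp add: Y_def d_def)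
        qed
      qed
    qed
  qed
qed

theorem theorem2:
  "\<exists>(P :: com) (c :: nat). \<forall>(G :: nat rbgraph) (n :: nat) (k :: int) (\<gamma> :: int).
     rb_reinforcement_instance G k \<gamma> \<and> verts G = {..<n} \<longrightarrow>
     (let T = c * 3 ^ dist_to_cluster G * (n + 1) ^ c in
       \<exists>t s. exec (int T + \<bar>k\<bar> + \<bar>\<gamma>\<bar>) P (input_state G n k \<gamma>) t s \<and> t \<le> T \<and>
             reg s ''answer'' = (if rb_reinforcement G k \<gamma> then 1 else 0))"
proof -
  \<comment> \<open>One constant serves as factor and as exponent; hiding its value keeps
    \<open>(n + 1) ^ 14000\<close> out of the terms.\<close>
  obtain c :: nat where c: "c = 14000" by blast
  show ?thesis
  proof (intro exI[of _ solver] exI[of _ c] allI impI)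
    fix G :: "nat rbgraph" and n :: nat and k \<gamma> :: int
    assume G: "rb_reinforcement_instance G k \<gamma> \<and> verts G = {..<n}"
    define T where "T = c * 3 ^ dist_to_cluster G * (n + 1) ^ c"
    have "14000 * 3 ^ dist_to_cluster G * (n + 1) ^ 7 \<le> c * 3 ^ dist_to_cluster G * (n + 1) ^ c"
      by (intro mult_le_mono power_increasing) (simp_all add: c)
    then have T: "14000 * 3 ^ dist_to_cluster G * (n + 1) ^ 7 \<le> T" unfolding T_def .
    then have "int (14000 * 3 ^ dist_to_cluster G * (n + 1) ^ 7) \<le> int T + \<bar>k\<bar> + \<bar>\<gamma>\<bar>" by linarith
    from wp_solver[OF _ _ this, of k \<gamma>] G obtain t s
      where "exec (int T + \<bar>k\<bar> + \<bar>\<gamma>\<bar>) solver (input_state G n k \<gamma>) t s"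
        "t \<le> 14000 * 3 ^ dist_to_cluster G * (n + 1) ^ 7"
        "reg s ''answer'' = (if rb_reinforcement G k \<gamma> then 1 else 0)"
      unfolding wp_def rb_reinforcement_instance_def by blast
    with T show "let T = c * 3 ^ dist_to_cluster G * (n + 1) ^ c in
       \<exists>t s. exec (int T + \<bar>k\<bar> + \<bar>\<gamma>\<bar>) solver (input_state G n k \<gamma>) t s \<and> t \<le> T \<and>
             reg s ''answer'' = (if rb_reinforcement G k \<gamma> then 1 else 0)"
      unfolding Let_def T_def[symmetric] by (meson le_trans)
  qed
qed

end
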